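(* Let $\kappa_1<\kappa_2$ be real numbers and let $\boldsymbol{P},\boldsymbol{Q}\in \mathrm{SO}_3(\mathbb{R})$. Let $\mathcal{P}_{\kappa_1}^{\kappa_2}(\boldsymbol{P},\boldsymbol{Q})$ be the set of curves $\gamma\in\mathcal{I}(\boldsymbol{P},\boldsymbol{Q})$ whose tangent vector $\dot\gamma$ is Lipschitz continuous and whose (a.e. defined) geodesic curvature $\kappa$ satisfies $\kappa_1<\operatorname{ess\,inf}_{t\in[0,1]}\kappa(t)\le \operatorname{ess\,sup}_{t\in[0,1]}\kappa(t)<\kappa_2$. Let $\mathcal{S}_{\kappa_1}^{\kappa_2}(\boldsymbol{P},\boldsymbol{Q})$ be the set of curves $\gamma\in\mathcal{I}(\boldsymbol{P},\boldsymbol{Q})$ whose lower and upper curvatures satisfy $\kappa_1<\inf_{t\in[0,1]}\kappa_\gamma^-(t)\le\sup_{t\in[0,1]}\kappa_\gamma^+(t)<\kappa_2$. Then $\mathcal{P}_{\kappa_1}^{\kappa_2}(\boldsymbol{P},\boldsymbol{Q})=\mathcal{S}_{\kappa_1}^{\kappa_2}(\boldsymbol{P},\boldsymbol{Q})$.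
   Context: $\mathbb{S}^2\subset\mathbb{R}^3$ is the unit sphere and $d$ its surface (great-circle) distance. A $C^1$ regular parameterized curve is a $C^1$ map $\gamma:I\to\mathbb{S}^2$, $I$ a compact interval, with $\dot\gamma(t)\ne 0$ for all $t\in I$. Two such curves are identified if they differ by a $C^1$ bijective reparameterization with positive derivative; a $C^1$ regular curve is such an equivalence class, and unless stated otherwise it is represented by its parameterization $\gamma:[0,1]\to\mathbb{S}^2$ of constant speed $|\dot\gamma|\equiv L_\gamma$ (the length of $\gamma$). Write $\boldsymbol{t}_\gamma=\dot\gamma/|\dot\gamma|$ for the unit tangent vector and $\boldsymbol{n}_\gamma=\gamma\times\boldsymbol{t}_\gamma$ for the unit normal vector. The Frenet frame $\mathfrak{F}_\gamma(t)\in\mathrm{SO}_3(\mathbb{R})$ is the matrix with columns $\gamma(t),\boldsymbol{t}_\gamma(t),\boldsymbol{n}_\gamma(t)$. $\mathcal{I}(\boldsymbol{P},\boldsymbol{Q})$ is the set of all $C^1$ regular curves with $\mathfrak{F}_\gamma(0)=\boldsymbol{P}$ and $\mathfrak{F}_\gamma(1)=\boldsymbol{Q}$. If $\dot\gamma$ is Lipschitz, then in terms of the arc-length $s$ the derivative $\boldsymbol{t}_\gamma'(s)$ exists for a.e. $s$, and the geodesic curvature is $\kappa(s)=\langle\boldsymbol{t}_\gamma'(s),\boldsymbol{n}_\gamma(s)\rangle$, so that $\boldsymbol{t}_\gamma'=-\gamma+\kappa\boldsymbol{n}_\gamma$ a.e.; $\kappa(t)$ means $\kappa(s(t))$. Upper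 and lower curvatures. Let $\gamma:I\to\mathbb{S}^2$ be a $C^1$ regular curve, $t_1\in I$, and let $\zeta$ be an oriented circle in $\mathbb{S}^2$. Let $a$ be the center of $\zeta$ with respect to which $\zeta$ travels anti-clockwise (i.e. the center lying on the left side of $\zeta$, the side of $\boldsymbol{n}_\zeta$), and let $r\in(0,\pi)$ be the spherical radius of $\zeta$ relative to $a$. The circle $\zeta$ is tangent from left to $\gamma$ at $\gamma(t_1)$ if (1) $\zeta$ passes through $\gamma(t_1)$ with unit tangent vector equal to $\boldsymbol{t}_\gamma(t_1)$ there (equivalently $a=(\cos r)\gamma(t_1)+(\sin r)\boldsymbol{n}_\gamma(t_1)$), and (2) there is $\delta>0$ such that $d(\gamma(t),a)\ge r$ for all $t\in(t_1-\delta,t_1+\delta)\cap I$. It is tangent from right to $\gamma$ at $\gamma(t_1)$ if (1) holds and there is $\delta>0$ such that $d(\gamma(t),a)\le r$ for all $t\in(t_1-\delta,t_1+\delta)\cap I$. Define $\kappa_\gamma^+(t)=\inf\{\cot r: r \text{ is the radius of a circle tangent from left to }\gamma\text{ at }\gamma(t)\}$ and $\kappa_\gamma^-(t)=\sup\{\cot r: r \text{ is the radius of a circle tangent from right to }\gamma\text{ at }\gamma(t)\}$, with $\inf\emptyset=+\infty$ and $\sup\emptyset=-\infty$. *)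

theory Defs
  imports "HOL-Probability.Essential_Supremum"
begin

section \<open>Regular curves on the unit sphere\<close>

text \<open>Derivatives on a compact interval are one-sided at its endpoints.\<close>

definition velocity :: "real set \<Rightarrow> (real \<Rightarrow> 'a::real_normed_vector) \<Rightarrow> real \<Rightarrow> 'a" where
  "velocity I f t = vector_derivative f (at t within I)"

definition C1_on :: "real set \<Rightarrow> (real \<Rightarrow> 'a::real_normed_vector) \<Rightarrow> bool" where
  "C1_on I f \<longleftrightarrow> f differentiable_on I \<and> continuous_on I (velocity I f)"

text \<open>A parameterized curve is a triple \<open>(a, b, \<gamma>)\<close> with domain \<open>{a..b}\<close>; the values of \<open>\<gamma>\<close>
  outside \<open>{a..b}\<close> are irrelevant, and the relation below identifies triples that
  differ only there.\<close>

type_synonym pcurve = "real \<times> real \<times> (real \<Rightarrow> real^3)"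

definition regular_pcurves :: "pcurve set" where
  "regular_pcurves = {(a, b, \<gamma>). a < b \<and> \<gamma> ` {a..b} \<subseteq> sphere 0 1 \<and> C1_on {a..b} \<gamma>
     \<and> (\<forall>t\<in>{a..b}. velocity {a..b} \<gamma> t \<noteq> 0)}"

definition reparam :: "(pcurve \<times> pcurve) set" where
  "reparam = {((a, b, \<gamma>), (c, d, \<eta>)).
     (a, b, \<gamma>) \<in> regular_pcurves \<and> (c, d, \<eta>) \<in> regular_pcurves \<and>
     (\<exists>\<phi>::real \<Rightarrow> real. bij_betw \<phi> {c..d} {a..b} \<and> C1_on {c..d} \<phi>
        \<and> (\<forall>t\<in>{c..d}. velocity {c..d} \<phi> t > 0)
        \<and> (\<forall>t\<in>{c..d}. \<eta> t = \<gamma> (\<phi> t)))}"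

definition regular_curves :: "pcurve set set" where
  "regular_curves = regular_pcurves // reparam"

definition const_speed_rep :: "pcurve set \<Rightarrow> (real \<Rightarrow> real^3) \<Rightarrow> bool" where
  "const_speed_rep C \<gamma> \<longleftrightarrow>
     (0, 1, \<gamma>) \<in> C \<and> (\<exists>L. \<forall>t\<in>{0..1}. norm (velocity {0..1} \<gamma> t) = L)"

section \<open>Frenet frame and geodesic curvature\<close>

definition unit_tangent :: "real set \<Rightarrow> (real \<Rightarrow> real^3) \<Rightarrow> real \<Rightarrow> real^3" where
  "unit_tangent I \<gamma> t = velocity I \<gamma> t /\<^sub>R norm (velocity I \<gamma> t)"

definition unit_normal :: "real set \<Rightarrow> (real \<Rightarrow> real^3) \<Rightarrow> real \<Rightarrow> real^3" where
  "unit_normal I \<gamma> t = cross3 (\<gamma> t) (unit_tangent I \<gamma> t)"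

definition frenet_frame :: "real set \<Rightarrow> (real \<Rightarrow> real^3) \<Rightarrow> real \<Rightarrow> real^3^3" where
  "frenet_frame I \<gamma> t = transpose (vector [\<gamma> t, unit_tangent I \<gamma> t, unit_normal I \<gamma> t])"

text \<open>Dividing by the speed turns the derivative of the unit tangent in the parameter into its
  derivative in arc-length. Where the unit tangent is not differentiable, the value is
  unspecified.\<close>

definition geodesic_curvature :: "real set \<Rightarrow> (real \<Rightarrow> real^3) \<Rightarrow> real \<Rightarrow> real" where
  "geodesic_curvature I \<gamma> t =
     (velocity I (unit_tangent I \<gamma>) t /\<^sub>R norm (velocity I \<gamma> t)) \<bullet> unit_normal I \<gamma> t"

definition essinf :: "'a measure \<Rightarrow> ('a \<Rightarrow> ereal) \<Rightarrow> ereal" where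
  "essinf M f = - esssup M (\<lambda>x. - f x)"

section \<open>Tangent circles, upper and lower curvatures\<close>

definition sphere_dist :: "real^3 \<Rightarrow> real^3 \<Rightarrow> real" where
  "sphere_dist x y = arccos (x \<bullet> y)"

text \<open>An oriented circle is given by the center \<open>a\<close> on its left and the spherical radius \<open>r\<close>
  relative to \<open>a\<close>. Travelling anti-clockwise about \<open>a\<close>, its unit tangent vector at
  a point \<open>x\<close> is the normalization of \<open>a \<times> x\<close>, whose norm is \<open>sin r\<close>.\<close>

definition circle_tangent :: "real^3 \<Rightarrow> real \<Rightarrow> real^3 \<Rightarrow> real^3" where
  "circle_tangent a r x = cross3 a x /\<^sub>R sin r"

definition circle_touches ::
    "real set \<Rightarrow> (real \<Rightarrow> real^3) \<Rightarrow> real \<Rightarrow> real^3 \<Rightarrow> real \<Rightarrow> bool" where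
  "circle_touches I \<gamma> t a r \<longleftrightarrow> a \<in> sphere 0 1 \<and> 0 < r \<and> r < pi
     \<and> sphere_dist (\<gamma> t) a = r \<and> circle_tangent a r (\<gamma> t) = unit_tangent I \<gamma> t"

definition tangent_from_left ::
    "real set \<Rightarrow> (real \<Rightarrow> real^3) \<Rightarrow> real \<Rightarrow> real^3 \<Rightarrow> real \<Rightarrow> bool" where
  "tangent_from_left I \<gamma> t\<^sub>1 a r \<longleftrightarrow> circle_touches I \<gamma> t\<^sub>1 a r
     \<and> (\<exists>\<delta>>0. \<forall>t\<in>{t\<^sub>1 - \<delta><..<t\<^sub>1 + \<delta>} \<inter> I. sphere_dist (\<gamma> t) a \<ge> r)"

definition tangent_from_right ::
    "real set \<Rightarrow> (real \<Rightarrow> real^3) \<Rightarrow> real \<Rightarrow> real^3 \<Rightarrow> real \<Rightarrow> bool" where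
  "tangent_from_right I \<gamma> t\<^sub>1 a r \<longleftrightarrow> circle_touches I \<gamma> t\<^sub>1 a r
     \<and> (\<exists>\<delta>>0. \<forall>t\<in>{t\<^sub>1 - \<delta><..<t\<^sub>1 + \<delta>} \<inter> I. sphere_dist (\<gamma> t) a \<le> r)"

definition upper_curvature :: "real set \<Rightarrow> (real \<Rightarrow> real^3) \<Rightarrow> real \<Rightarrow> ereal" where
  "upper_curvature I \<gamma> t = Inf {ereal (cot r) | r. \<exists>a. tangent_from_left I \<gamma> t a r}"

definition lower_curvature :: "real set \<Rightarrow> (real \<Rightarrow> real^3) \<Rightarrow> real \<Rightarrow> ereal" where
  "lower_curvature I \<gamma> t = Sup {ereal (cot r) | r. \<exists>a. tangent_from_right I \<gamma> t a r}"

lemma cross_frame: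
  fixes x t :: "real^3"
  assumes x: "norm x = 1" and t: "norm t = 1" and xt: "x \<bullet> t = 0"
  shows "norm (cross3 x t) = 1" "cross3 (cross3 x t) x = t" "cross3 t x = - cross3 x t"
proof -
  have xx: "x \<bullet> x = 1" "t \<bullet> t = 1" using x t by (simp_all add: norm_eq_1)
  have "(cross3 x t) \<bullet> (cross3 x t) = 1"
    using norm_cross_dot[of x t] x t xt by (simp add: power2_norm_eq_inner[symmetric] norm_eq_1)
  then show "norm (cross3 x t) = 1" by (simp add: norm_eq_1)
  show sk: "cross3 t x = - cross3 x t" by (rule cross_skew)
  have "cross3 (cross3 x t) x = - cross3 x (cross3 x t)" by (rule cross_skew)
  also have "\<dots> = t" using xx xt by (simp add: Lagrange)
  finally show "cross3 (cross3 x t) x = t" .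
qed

lemma velocityI:
  assumes "a < b" "t \<in> {a..b}" "(f has_vector_derivative D) (at t within {a..b})"
  shows "velocity {a..b} f t = D"
  using vector_derivative_within_cbox[of a b t f D] assms by (simp add: velocity_def)

lemma C1_onD:
  assumes "C1_on I f" "t \<in> I"
  shows "(f has_vector_derivative velocity I f t) (at t within I)"
  using assms by (simp add: C1_on_def differentiable_on_def velocity_def
      vector_derivative_works[symmetric])

lemma C1_onI:
  assumes "a < b" "\<And>t. t \<in> {a..b} \<Longrightarrow> (f has_vector_derivative D t) (at t within {a..b})"
    "continuous_on {a..b} D"
  shows "C1_on {a..b} f"
proof -
  have "velocity {a..b} f t = D t" if "t \<in> {a..b}" for t
    using velocityI assms that by blast
  then have "continuous_on {a..b} (velocity {a..b} f)"
    using assms(3) continuous_on_cong[of "{a..b}" "{a..b}" "velocity {a..b} f" D] by blast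
  moreover have "f differentiable_on {a..b}"
    unfolding differentiable_on_def differentiable_def
    using assms(2) has_vector_derivative_def by blast
  ultimately show ?thesis by (simp add: C1_on_def)
qed

lemma regular_pcurve_orthonormal:
  assumes "(a, b, \<gamma>) \<in> regular_pcurves" "t \<in> {a..b}"
  shows "norm (\<gamma> t) = 1" "norm (unit_tangent {a..b} \<gamma> t) = 1"
    "\<gamma> t \<bullet> unit_tangent {a..b} \<gamma> t = 0"
proof -
  have ab: "a < b" and C: "C1_on {a..b} \<gamma>" and v: "velocity {a..b} \<gamma> t \<noteq> 0"
    and n: "\<And>s. s \<in> {a..b} \<Longrightarrow> norm (\<gamma> s) = 1"
    using assms by (auto simp: regular_pcurves_def image_subset_iff)
  show "norm (\<gamma> t) = 1" "norm (unit_tangent {a..b} \<gamma> t) = 1"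
    using n assms(2) v by (auto simp: unit_tangent_def)
  note d = C1_onD[OF C assms(2)]
  have "((\<lambda>s. \<gamma> s \<bullet> \<gamma> s) has_vector_derivative
      \<gamma> t \<bullet> velocity {a..b} \<gamma> t + velocity {a..b} \<gamma> t \<bullet> \<gamma> t) (at t within {a..b})"
    using bounded_bilinear.has_vector_derivative[OF bounded_bilinear_inner d d] .
  moreover have "((\<lambda>s. \<gamma> s \<bullet> \<gamma> s) has_vector_derivative 0) (at t within {a..b})"
    by (rule has_vector_derivative_transform[OF assms(2) _ has_vector_derivative_const[of 1]])
      (use n in \<open>auto simp: norm_eq_1\<close>)
  ultimately have "\<gamma> t \<bullet> velocity {a..b} \<gamma> t + velocity {a..b} \<gamma> t \<bullet> \<gamma> t = 0"
    using velocityI[OF ab assms(2)] by metis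
  then show "\<gamma> t \<bullet> unit_tangent {a..b} \<gamma> t = 0"
    by (simp add: unit_tangent_def inner_commute)
qed

lemma circle_touches_iff:
  assumes "(a, b, \<gamma>) \<in> regular_pcurves" "t \<in> {a..b}"
  shows "circle_touches {a..b} \<gamma> t c r \<longleftrightarrow>
    0 < r \<and> r < pi \<and> c = cos r *\<^sub>R \<gamma> t + sin r *\<^sub>R unit_normal {a..b} \<gamma> t"
proof (cases "0 < r \<and> r < pi")
  case False
  then show ?thesis by (auto simp: circle_touches_def)
next
  case True
  define x where "x = \<gamma> t"
  define u where "u = unit_tangent {a..b} \<gamma> t"
  have x: "norm x = 1" and u: "norm u = 1" and xu: "x \<bullet> u = 0"
    using regular_pcurve_orthonormal[OF assms] by (simp_all add: x_def u_def)
  note fr = cross_frame[OF x u xu]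
  have xx: "x \<bullet> x = 1" using x by (simp add: norm_eq_1)
  have s: "sin r > 0" using True by (simp add: sin_gt_zero)
  have "norm c = 1 \<and> arccos (x \<bullet> c) = r \<and> cross3 c x /\<^sub>R sin r = u
     \<longleftrightarrow> c = cos r *\<^sub>R x + sin r *\<^sub>R cross3 x u" (is "?L \<longleftrightarrow> ?R")
  proof
    assume L: ?L
    then have "\<bar>x \<bullet> c\<bar> \<le> 1" using Cauchy_Schwarz_ineq2[of x c] x by simp
    then have xc: "x \<bullet> c = cos r" using L cos_arccos_abs by fastforce
    have cx: "cross3 c x = sin r *\<^sub>R u" using L s by auto
    have "cross3 x (cross3 c x) = c - cos r *\<^sub>R x"
      using xx xc by (simp add: Lagrange)
    then show ?R using cx by (simp add: cross_mult_right algebra_simps)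
  next
    assume R: ?R
    have "c \<bullet> c = (cos r)\<^sup>2 * (x \<bullet> x) + (sin r)\<^sup>2 * (cross3 x u \<bullet> cross3 x u)"
      unfolding R by (simp add: inner_add_left inner_add_right dot_cross_self power2_eq_square
          inner_commute[of "cross3 x u" x])
    also have "\<dots> = 1" using xx fr(1) by (simp add: norm_eq_1)
    finally have "norm c = 1" by (simp add: norm_eq_1)
    moreover have "x \<bullet> c = cos r" unfolding R by (simp add: inner_add_right dot_cross_self xx)
    then have "arccos (x \<bullet> c) = r" using True by (simp add: arccos_cos)
    moreover have "cross3 c x = sin r *\<^sub>R u"
      unfolding R by (simp add: cross_add_left cross_mult_left fr)
    ultimately show ?L using s by simp
  qed
  then show ?thesis using True
    by (simp add: circle_touches_def sphere_dist_def circle_tangent_def unit_normal_def x_def u_def)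
qed

section \<open>Constant-speed representatives\<close>

lemma C1_on_compose:
  fixes \<phi> :: "real \<Rightarrow> real"
  assumes "a < b" "c < d" "C1_on {a..b} f" "C1_on {c..d} \<phi>" "\<phi> ` {c..d} = {a..b}"
    "\<And>t. t \<in> {c..d} \<Longrightarrow> g t = f (\<phi> t)"
  shows "C1_on {c..d} g"
    "\<And>t. t \<in> {c..d} \<Longrightarrow>
      velocity {c..d} g t = velocity {c..d} \<phi> t *\<^sub>R velocity {a..b} f (\<phi> t)"
proof -
  have d: "(g has_vector_derivative velocity {c..d} \<phi> t *\<^sub>R velocity {a..b} f (\<phi> t))
      (at t within {c..d})" if t: "t \<in> {c..d}" for t
  proof -
    have "\<phi> t \<in> {a..b}" using assms(5) t by blast
    then have "(f \<circ> \<phi> has_vector_derivative velocity {c..d} \<phi> t *\<^sub>R velocity {a..b} f (\<phi> t))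
      (at t within {c..d})"
      by (intro vector_diff_chain_within C1_onD[OF assms(4) t])
        (use C1_onD[OF assms(3), of "\<phi> t"] assms(5) in simp)
    then show ?thesis
      by (rule has_vector_derivative_transform[OF t, rotated]) (use assms(6) in auto)
  qed
  have c\<phi>: "continuous_on {c..d} \<phi>"
    using assms(4) by (simp add: C1_on_def differentiable_imp_continuous_on)
  have "continuous_on {c..d} (\<lambda>t. velocity {a..b} f (\<phi> t))"
    by (rule continuous_on_compose2[OF _ c\<phi>, of "{a..b}"])
      (use assms(3,5) in \<open>auto simp: C1_on_def\<close>)
  then have "continuous_on {c..d} (\<lambda>t. velocity {c..d} \<phi> t *\<^sub>R velocity {a..b} f (\<phi> t))"
    using assms(4) by (intro continuous_intros) (simp_all add: C1_on_def)
  then show "C1_on {c..d} g" using C1_onI[OF assms(2) d] by simp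
  show "\<And>t. t \<in> {c..d} \<Longrightarrow>
      velocity {c..d} g t = velocity {c..d} \<phi> t *\<^sub>R velocity {a..b} f (\<phi> t)"
    using velocityI[OF assms(2) _ d] by simp
qed

lemma C1_on_inverse:
  fixes \<phi> :: "real \<Rightarrow> real"
  assumes "a < b" "c < d" "C1_on {c..d} \<phi>" "bij_betw \<phi> {c..d} {a..b}"
    and pos: "\<And>t. t \<in> {c..d} \<Longrightarrow> velocity {c..d} \<phi> t > 0"
  defines "\<psi> \<equiv> inv_into {c..d} \<phi>"
  shows "C1_on {a..b} \<psi>" "\<And>y. y \<in> {a..b} \<Longrightarrow> velocity {a..b} \<psi> y = inverse (velocity {c..d} \<phi> (\<psi> y))"
proof -
  have im: "\<phi> ` {c..d} = {a..b}" and inj: "inj_on \<phi> {c..d}"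
    using assms(4) by (auto simp: bij_betw_def)
  have c\<phi>: "continuous_on {c..d} \<phi>"
    using assms(3) by (simp add: C1_on_def differentiable_imp_continuous_on)
  have l: "\<psi> (\<phi> t) = t" if "t \<in> {c..d}" for t using inj that by (simp add: \<psi>_def)
  have r: "\<phi> (\<psi> y) = y" "\<psi> y \<in> {c..d}" if "y \<in> {a..b}" for y
    using that im unfolding \<psi>_def by (metis f_inv_into_f, metis inv_into_into)
  have c\<psi>: "continuous_on {a..b} \<psi>"
    using continuous_on_inv[OF c\<phi>] l im by auto
  have d: "(\<psi> has_vector_derivative inverse (velocity {c..d} \<phi> (\<psi> y))) (at y within {a..b})"
    if y: "y \<in> {a..b}" for y
  proof -
    have "(\<phi> has_field_derivative velocity {c..d} \<phi> (\<psi> y)) (at (\<psi> y) within {c..d})"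
      using C1_onD[OF assms(3) r(2)[OF y]] by (simp add: has_real_derivative_iff_has_vector_derivative)
    then obtain h where h: "\<And>z. \<phi> z - \<phi> (\<psi> y) = h z * (z - \<psi> y)"
      "continuous (at (\<psi> y) within {c..d}) h" "h (\<psi> y) = velocity {c..d} \<phi> (\<psi> y)"
      unfolding DERIV_caratheodory_within by blast
    have h0: "h (\<psi> w) \<noteq> 0" if "w \<in> {a..b}" for w
      using h(1)[of "\<psi> w"] r[OF that] r[OF y] pos[OF r(2)[OF y]] h(3)
      by (cases "w = y") auto
    have cc: "continuous (at y within {a..b}) (\<lambda>w. inverse (h (\<psi> w)))"
    proof (rule continuous_at_within_inverse)
      have "continuous (at (\<psi> y) within \<psi> ` {a..b}) h"
        using h(2) by (rule continuous_within_subset) (use r in auto)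
      then show "continuous (at y within {a..b}) (\<lambda>w. h (\<psi> w))"
        using continuous_within_compose2[of y "{a..b}" \<psi> h] c\<psi> y
        by (simp add: continuous_on_eq_continuous_within)
    qed (use h0 y in auto)
    define k where "k = (\<lambda>w. if w \<in> {a..b} then inverse (h (\<psi> w)) else (\<psi> w - \<psi> y) / (w - y))"
    have "\<psi> w - \<psi> y = k w * (w - y)" for w
      using h(1)[of "\<psi> w"] h0[of w] r[of w] r[OF y] y by (auto simp: k_def field_simps)
    moreover have "continuous (at y within {a..b}) k"
      by (rule continuous_transform_within[OF cc, of 1]) (use y in \<open>auto simp: k_def\<close>)
    moreover have "k y = inverse (velocity {c..d} \<phi> (\<psi> y))" using y h(3) by (simp add: k_def)
    ultimately have "(\<psi> has_field_derivative inverse (velocity {c..d} \<phi> (\<psi> y))) (at y within {a..b})"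
      unfolding DERIV_caratheodory_within by blast
    then show ?thesis by (simp add: has_real_derivative_iff_has_vector_derivative)
  qed
  have "continuous_on {a..b} (\<lambda>y. velocity {c..d} \<phi> (\<psi> y))"
    by (rule continuous_on_compose2[OF _ c\<psi>, of "{c..d}"])
      (use assms(3) r(2) in \<open>auto simp: C1_on_def\<close>)
  then have "continuous_on {a..b} (\<lambda>y. inverse (velocity {c..d} \<phi> (\<psi> y)))"
    by (rule continuous_on_inverse) (use pos r(2) in force)
  then show "C1_on {a..b} \<psi>" using C1_onI[OF assms(1) d] by simp
  show "\<And>y. y \<in> {a..b} \<Longrightarrow> velocity {a..b} \<psi> y = inverse (velocity {c..d} \<phi> (\<psi> y))"
    using velocityI[OF assms(1) _ d] by simp
qed

lemma equiv_reparam: "equiv regular_pcurves reparam"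
proof (rule equivI)
  show "reparam \<subseteq> regular_pcurves \<times> regular_pcurves" by (auto simp: reparam_def)
  show "refl_on regular_pcurves reparam"
  proof (rule refl_onI)
    fix p assume p: "p \<in> regular_pcurves"
    obtain a b \<gamma> where [simp]: "p = (a, b, \<gamma>)" by (cases p)
    have ab: "a < b" using p by (auto simp: regular_pcurves_def)
    have d: "((\<lambda>t. t) has_vector_derivative 1) (at t within {a..b})" for t by (rule has_vector_derivative_id)
    have "C1_on {a..b} (\<lambda>t. t)" using C1_onI[OF ab d] by simp
    moreover have "\<forall>t\<in>{a..b}. velocity {a..b} (\<lambda>t. t) t > 0" using velocityI[OF ab _ d] by simp
    moreover have "bij_betw (\<lambda>t. t) {a..b} {a..b}" by (auto simp: bij_betw_def inj_on_def)
    ultimately show "(p, p) \<in> reparam" using p unfolding reparam_def by force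
  qed
  show "sym reparam"
  proof (rule symI)
    fix p q assume pq: "(p, q) \<in> reparam"
    obtain a b \<gamma> c d \<eta> where [simp]: "p = (a, b, \<gamma>)" "q = (c, d, \<eta>)" by (cases p, cases q)
    obtain \<phi> :: "real \<Rightarrow> real" where p: "p \<in> regular_pcurves" "q \<in> regular_pcurves"
      and \<phi>: "bij_betw \<phi> {c..d} {a..b}" "C1_on {c..d} \<phi>"
        "\<And>t. t \<in> {c..d} \<Longrightarrow> velocity {c..d} \<phi> t > 0" "\<And>t. t \<in> {c..d} \<Longrightarrow> \<eta> t = \<gamma> (\<phi> t)"
      using pq by (auto simp: reparam_def)
    have ab: "a < b" "c < d" using p by (auto simp: regular_pcurves_def)
    let ?\<psi> = "inv_into {c..d} \<phi>"
    note inv = C1_on_inverse[OF ab \<phi>(2,1,3)]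
    have b: "bij_betw ?\<psi> {a..b} {c..d}" using \<phi>(1) by (rule bij_betw_inv_into)
    have "\<phi> (?\<psi> y) = y" "?\<psi> y \<in> {c..d}" if "y \<in> {a..b}" for y
      using \<phi>(1) b that by (simp add: bij_betw_inv_into_right, meson bij_betwE)
    then have "\<forall>t\<in>{a..b}. \<gamma> t = \<eta> (?\<psi> t)" "\<forall>t\<in>{a..b}. velocity {a..b} ?\<psi> t > 0"
      using \<phi>(3,4) inv(2) by simp_all
    then show "(q, p) \<in> reparam" using p b inv(1) unfolding reparam_def by auto
  qed
  show "trans reparam"
  proof (rule transI)
    fix p q w assume pq: "(p, q) \<in> reparam" and qw: "(q, w) \<in> reparam"
    obtain a b \<gamma> c d \<eta> e f \<theta> where [simp]: "p = (a, b, \<gamma>)" "q = (c, d, \<eta>)" "w = (e, f, \<theta>)"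
      by (cases p, cases q, cases w)
    obtain \<phi> :: "real \<Rightarrow> real" where p: "p \<in> regular_pcurves" "q \<in> regular_pcurves"
      and \<phi>: "bij_betw \<phi> {c..d} {a..b}" "C1_on {c..d} \<phi>"
        "\<And>t. t \<in> {c..d} \<Longrightarrow> velocity {c..d} \<phi> t > 0" "\<And>t. t \<in> {c..d} \<Longrightarrow> \<eta> t = \<gamma> (\<phi> t)"
      using pq by (auto simp: reparam_def)
    obtain \<psi> :: "real \<Rightarrow> real" where w: "w \<in> regular_pcurves"
      and \<psi>: "bij_betw \<psi> {e..f} {c..d}" "C1_on {e..f} \<psi>"
        "\<And>t. t \<in> {e..f} \<Longrightarrow> velocity {e..f} \<psi> t > 0" "\<And>t. t \<in> {e..f} \<Longrightarrow> \<theta> t = \<eta> (\<psi> t)"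
      using qw by (auto simp: reparam_def)
    have ab: "a < b" "c < d" "e < f" using p w by (auto simp: regular_pcurves_def)
    have im: "\<psi> ` {e..f} = {c..d}" using \<psi>(1) by (simp add: bij_betw_def)
    note co = C1_on_compose[OF ab(2,3) \<phi>(2) \<psi>(2) im, of "\<phi> \<circ> \<psi>"]
    have "bij_betw (\<phi> \<circ> \<psi>) {e..f} {a..b}" using \<psi>(1) \<phi>(1) by (rule bij_betw_trans)
    moreover have "C1_on {e..f} (\<phi> \<circ> \<psi>)" using co(1) by simp
    moreover have "velocity {e..f} (\<phi> \<circ> \<psi>) t > 0" if "t \<in> {e..f}" for t
    proof -
      have "\<psi> t \<in> {c..d}" using im that by blast
      then show ?thesis using co(2)[OF _ that] \<psi>(3)[OF that] \<phi>(3)[of "\<psi> t"] by simp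
    qed
    moreover have "\<theta> t = \<gamma> ((\<phi> \<circ> \<psi>) t)" if "t \<in> {e..f}" for t
    proof -
      have "\<psi> t \<in> {c..d}" using im that by blast
      then show ?thesis using \<psi>(4)[OF that] \<phi>(4)[of "\<psi> t"] by simp
    qed
    ultimately show "(p, w) \<in> reparam" using p w unfolding reparam_def by auto
  qed
qed

lemma const_speed_rep_exists:
  assumes "C \<in> regular_curves"
  shows "\<exists>\<gamma>. const_speed_rep C \<gamma>"
proof -
  obtain p where p: "p \<in> regular_pcurves" and C: "C = reparam `` {p}"
    using assms unfolding regular_curves_def by (rule quotientE)
  obtain a b \<gamma> where [simp]: "p = (a, b, \<gamma>)" by (cases p)
  have ab: "a < b" and \<gamma>: "\<gamma> ` {a..b} \<subseteq> sphere 0 1" "C1_on {a..b} \<gamma>"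
    and v0: "\<And>t. t \<in> {a..b} \<Longrightarrow> velocity {a..b} \<gamma> t \<noteq> 0"
    using p by (auto simp: regular_pcurves_def)
  define v where "v = (\<lambda>t. norm (velocity {a..b} \<gamma> t))"
  have cv: "continuous_on {a..b} v"
    using \<gamma>(2) unfolding v_def C1_on_def by (intro continuous_intros) simp
  have vpos: "v t > 0" if "t \<in> {a..b}" for t using v0[OF that] by (simp add: v_def)
  define l where "l = (\<lambda>t. integral {a..t} v)"
  have dl: "(l has_vector_derivative v t) (at t within {a..b})" if "t \<in> {a..b}" for t
    unfolding l_def using integral_has_vector_derivative[OF cv that] .
  have cl: "continuous_on {a..b} l"
    using C1_onI[OF ab dl cv] by (simp add: C1_on_def differentiable_imp_continuous_on)
  have mono: "l s < l t" if "s < t" "s \<in> {a..b}" "t \<in> {a..b}" for s t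
  proof (rule DERIV_pos_imp_increasing_open[OF that(1)])
    fix x assume "s < x" "x < t"
    then have x: "a < x" "x < b" using that by auto
    then have "(l has_field_derivative v x) (at x)"
      using dl[of x] by (simp add: at_within_Icc_at has_real_derivative_iff_has_vector_derivative)
    then show "\<exists>y. (l has_field_derivative y) (at x) \<and> y > 0" using vpos[of x] x by auto
  next
    show "continuous_on {s..t} l" using cl by (rule continuous_on_subset) (use that in auto)
  qed
  define L where "L = l b"
  have la: "l a = 0" by (simp add: l_def)
  have L: "L > 0" using mono[of a b] la ab by (simp add: L_def)
  define \<sigma> where "\<sigma> = (\<lambda>t. l t / L)"
  have d\<sigma>: "(\<sigma> has_vector_derivative v t / L) (at t within {a..b})" if "t \<in> {a..b}" for t
    unfolding \<sigma>_def using has_vector_derivative_divide[OF dl[OF that]] .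
  have C\<sigma>: "C1_on {a..b} \<sigma>"
    by (rule C1_onI[OF ab d\<sigma>]) (use cv L in \<open>auto intro!: continuous_intros\<close>)
  have v\<sigma>: "velocity {a..b} \<sigma> t = v t / L" if "t \<in> {a..b}" for t
    using velocityI[OF ab that d\<sigma>[OF that]] .
  have inj: "inj_on \<sigma> {a..b}"
  proof (rule linorder_inj_onI')
    fix s t assume "s \<in> {a..b}" "t \<in> {a..b}" "s < t"
    then show "\<sigma> s \<noteq> \<sigma> t" using mono[of s t] L by (simp add: \<sigma>_def)
  qed
  have "\<sigma> ` {a..b} = {0..1}"
  proof
    show "\<sigma> ` {a..b} \<subseteq> {0..1}"
    proof clarify
      fix t assume t: "t \<in> {a..b}"
      have "l a \<le> l t" "l t \<le> l b"
        using mono[of a t] mono[of t b] t ab by (cases "a = t"; cases "t = b"; auto)+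
      then show "\<sigma> t \<in> {0..1}" using la L by (simp add: \<sigma>_def L_def)
    qed
    show "{0..1} \<subseteq> \<sigma> ` {a..b}"
    proof
      fix y :: real assume y: "y \<in> {0..1}"
      have "continuous_on {a..b} \<sigma>"
        using C\<sigma> by (simp add: C1_on_def differentiable_imp_continuous_on)
      moreover have "\<sigma> a = 0" "\<sigma> b = 1" using la L by (simp_all add: \<sigma>_def L_def)
      ultimately show "y \<in> \<sigma> ` {a..b}"
        using IVT'[of \<sigma> a y b] y ab by force
    qed
  qed
  with inj have bij: "bij_betw \<sigma> {a..b} {0..1}" by (simp add: bij_betw_def)
  have \<sigma>pos: "velocity {a..b} \<sigma> t > 0" if "t \<in> {a..b}" for t
    using v\<sigma>[OF that] vpos[OF that] L by simp
  let ?\<psi> = "inv_into {a..b} \<sigma>"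
  have inv: "C1_on {0..1} ?\<psi>"
    "\<And>y. y \<in> {0..1} \<Longrightarrow> velocity {0..1} ?\<psi> y = inverse (velocity {a..b} \<sigma> (?\<psi> y))"
    using C1_on_inverse[OF zero_less_one ab C\<sigma> bij \<sigma>pos] by simp_all
  have b: "bij_betw ?\<psi> {0..1} {a..b}" using bij by (rule bij_betw_inv_into)
  then have im: "?\<psi> ` {0..1} = {a..b}" by (simp add: bij_betw_def)
  note co = C1_on_compose[OF ab zero_less_one \<gamma>(2) inv(1) im, of "\<gamma> \<circ> ?\<psi>"]
  have \<psi>: "?\<psi> t \<in> {a..b}" if "t \<in> {0..1}" for t using im that by blast
  have vel: "velocity {0..1} (\<gamma> \<circ> ?\<psi>) t = (L / v (?\<psi> t)) *\<^sub>R velocity {a..b} \<gamma> (?\<psi> t)"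
    if "t \<in> {0..1}" for t
    using co(2)[OF _ that] inv(2)[OF that] v\<sigma>[OF \<psi>[OF that]] by (simp add: inverse_eq_divide)
  have speed: "norm (velocity {0..1} (\<gamma> \<circ> ?\<psi>) t) = L" if "t \<in> {0..1}" for t
    using vel[OF that] vpos[OF \<psi>[OF that]] L by (simp add: v_def)
  have "(0, 1, \<gamma> \<circ> ?\<psi>) \<in> regular_pcurves"
    using co(1) speed L \<gamma>(1) \<psi> by (fastforce simp: regular_pcurves_def)
  moreover have "\<forall>t\<in>{0..1}. velocity {0..1} ?\<psi> t > 0"
    using inv(2) \<sigma>pos \<psi> by simp
  ultimately have "(p, (0, 1, \<gamma> \<circ> ?\<psi>)) \<in> reparam"
    using p b inv(1) unfolding reparam_def by auto
  then have "const_speed_rep C (\<gamma> \<circ> ?\<psi>)"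
    using speed by (auto simp: const_speed_rep_def C)
  then show ?thesis by blast
qed

lemma const_speed_rep_unique:
  assumes "C \<in> regular_curves" "const_speed_rep C \<gamma>" "const_speed_rep C \<eta>" "t \<in> {0..1}"
  shows "\<gamma> t = \<eta> t"
proof -
  have "((0, 1, \<gamma>), (0, 1, \<eta>)) \<in> reparam"
    using assms(1-3) quotient_eq_iff[OF equiv_reparam, of C C]
    by (auto simp: const_speed_rep_def regular_curves_def)
  then obtain \<phi> :: "real \<Rightarrow> real" where p: "(0, 1, \<gamma>) \<in> regular_pcurves" "(0, 1, \<eta>) \<in> regular_pcurves"
      and \<phi>: "bij_betw \<phi> {0..1} {0..1}" "C1_on {0..1} \<phi>"
        "\<And>t. t \<in> {0..1} \<Longrightarrow> velocity {0..1} \<phi> t > 0" "\<And>t. t \<in> {0..1} \<Longrightarrow> \<eta> t = \<gamma> (\<phi> t)"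
    by (auto simp: reparam_def)
  have C: "C1_on {0..1} \<gamma>" "\<And>t. t \<in> {0..1} \<Longrightarrow> velocity {0..1} \<gamma> t \<noteq> 0"
    using p by (auto simp: regular_pcurves_def)
  obtain L M where L: "\<And>t. t \<in> {0..1} \<Longrightarrow> norm (velocity {0..1} \<gamma> t) = L"
    and M: "\<And>t. t \<in> {0..1} \<Longrightarrow> norm (velocity {0..1} \<eta> t) = M"
    using assms(2,3) by (auto simp: const_speed_rep_def)
  have im: "\<phi> ` {0..1} = {0..1}" using \<phi>(1) by (simp add: bij_betw_def)
  have L0: "L > 0" using L[of 0] C(2)[of 0] by auto
  have v: "velocity {0..1} \<phi> t = M / L" if t: "t \<in> {0..1}" for t
  proof -
    have "velocity {0..1} \<eta> t = velocity {0..1} \<phi> t *\<^sub>R velocity {0..1} \<gamma> (\<phi> t)"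
      using C1_on_compose(2)[OF _ _ C(1) \<phi>(2) im \<phi>(4) t] by simp
    moreover have "\<phi> t \<in> {0..1}" using im t by blast
    ultimately have "M = velocity {0..1} \<phi> t * L"
      using M[OF t] L[of "\<phi> t"] \<phi>(3)[OF t] by simp
    then show ?thesis using L0 by simp
  qed
  have aff: "\<phi> s = \<phi> 0 + (M / L) * s" if s: "s \<in> {0..1}" for s
  proof -
    have "((\<lambda>s. \<phi> s - (M / L) * s) has_vector_derivative M / L - M / L * 1) (at s within {0..1})"
      if "s \<in> {0..1}" for s
      using C1_onD[OF \<phi>(2) that] v[OF that]
      by (intro has_vector_derivative_diff has_vector_derivative_mult_right
          has_vector_derivative_id) simp
    then have "((\<lambda>s. \<phi> s - (M / L) * s) has_derivative (\<lambda>h. 0)) (at s within {0..1})"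
      if "s \<in> {0..1}" for s using that by (simp add: has_vector_derivative_def)
    from has_derivative_zero_unique[OF _ this s, of 0]
    show ?thesis by auto
  qed
  have "0 \<in> \<phi> ` {0..1}" "1 \<in> \<phi> ` {0..1}" unfolding im by simp_all
  then obtain u w where u: "u \<in> {0..1}" "0 = \<phi> u" and w: "w \<in> {0..1}" "1 = \<phi> w"
    by (elim imageE)
  have "\<phi> 0 \<in> {0..1}" "\<phi> 1 \<in> {0..1}"
    using imageI[of 0 "{0..1}" \<phi>] imageI[of 1 "{0..1}" \<phi>] im by simp_all
  then have b: "\<phi> 0 \<ge> 0" "\<phi> 1 \<le> 1" by simp_all
  obtain k where k: "k = M / L" by blast
  have k0: "k > 0" using v[of 0] \<phi>(3)[of 0] by (simp add: k)
  have aff': "\<phi> s = \<phi> 0 + k * s" if "s \<in> {0..1}" for s using aff[OF that] by (simp only: k)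
  have "k * w \<le> k" "0 \<le> k * u"
    using mult_left_le[of w k] mult_nonneg_nonneg[of k u] k0 u(1) w(1) by simp_all
  moreover have "\<phi> 1 = \<phi> 0 + k" using aff'[of 1] by simp
  ultimately have "\<phi> 0 = 0" "k = 1"
    using aff'[OF u(1)] aff'[OF w(1)] u(2) w(2) b by linarith+
  then show ?thesis using aff'[OF assms(4)] \<phi>(4)[OF assms(4)] by simp
qed

section \<open>The spaces of curves\<close>

text \<open>By \<open>const_speed_rep_exists\<close> and \<open>const_speed_rep_unique\<close> a curve has a constant-speed
  representative on \<open>{0..1}\<close>, unique up to its irrelevant values outside \<open>{0..1}\<close>. So the
  existential quantifiers below all refer to one and the same parameterization.\<close>

definition curves_between :: "real^3^3 \<Rightarrow> real^3^3 \<Rightarrow> pcurve set set" where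
  "curves_between P Q = {C \<in> regular_curves. \<exists>\<gamma>. const_speed_rep C \<gamma>
     \<and> frenet_frame {0..1} \<gamma> 0 = P \<and> frenet_frame {0..1} \<gamma> 1 = Q}"

definition P_space :: "real \<Rightarrow> real \<Rightarrow> real^3^3 \<Rightarrow> real^3^3 \<Rightarrow> pcurve set set" where
  "P_space \<kappa>\<^sub>1 \<kappa>\<^sub>2 P Q = {C \<in> curves_between P Q. \<exists>\<gamma>. const_speed_rep C \<gamma>
     \<and> (\<exists>K. K-lipschitz_on {0..1} (velocity {0..1} \<gamma>))
     \<and> (let \<kappa> = (\<lambda>t. ereal (geodesic_curvature {0..1} \<gamma> t)); \<mu> = lebesgue_on {0..1} in
          ereal \<kappa>\<^sub>1 < essinf \<mu> \<kappa> \<and> essinf \<mu> \<kappa> \<le> esssup \<mu> \<kappa> \<and> esssup \<mu> \<kappa> < ereal \<kappa>\<^sub>2)}"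

definition S_space :: "real \<Rightarrow> real \<Rightarrow> real^3^3 \<Rightarrow> real^3^3 \<Rightarrow> pcurve set set" where
  "S_space \<kappa>\<^sub>1 \<kappa>\<^sub>2 P Q = {C \<in> curves_between P Q. \<exists>\<gamma>. const_speed_rep C \<gamma>
     \<and> (let m = (INF t\<in>{0..1}. lower_curvature {0..1} \<gamma> t);
            M = (SUP t\<in>{0..1}. upper_curvature {0..1} \<gamma> t) in
          ereal \<kappa>\<^sub>1 < m \<and> m \<le> M \<and> M < ereal \<kappa>\<^sub>2)}"

end

theory Submission
  imports Defs
begin

text \<open>
  Write \<open>T\<close> for the unit tangent and \<open>n\<close> for the unit normal of the curve. A circle of curvature
  \<open>k\<close> touching \<open>\<gamma>\<close> at \<open>t\<close> is tangent from the left iff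
  \<open>\<gamma> s \<bullet> n t \<le> k (1 - \<gamma> s \<bullet> \<gamma> t)\<close> for \<open>s\<close> near \<open>t\<close>, and from the right iff the reverse
  inequality holds.

  If the curvature is essentially less than \<open>k\<close>, then with \<open>w = n t + k \<gamma> t\<close> the Lipschitz
  function \<open>T s \<bullet> w\<close> vanishes at \<open>t\<close> and has negative derivative almost everywhere near
  \<open>t\<close>. So it is decreasing, \<open>\<gamma> s \<bullet> w\<close> has a local maximum at \<open>t\<close>, and this is the
  inequality above.

  Conversely, the inequality at every \<open>t\<close> holds only on a neighbourhood depending on \<open>t\<close>, and
  uniformity comes from a minimum principle: if \<open>k' > k\<close> and \<open>e\<close> is close to
  \<open>k' \<gamma> a + n a\<close>, then every critical point of \<open>\<gamma> s \<bullet> e\<close> with \<open>s\<close> close to \<open>a\<close> is a strict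
  local maximum, so this function cannot first decrease and then increase. For
  \<open>e = k' \<gamma> a + n a - \<eta> T a\<close> with \<open>\<eta>\<close> tending to \<open>0\<close> this gives
  \<open>T b \<bullet> n a \<le> - k' (T b \<bullet> \<gamma> a) = O(b - a)\<close>. With the analogous bound from the
  other side it follows that \<open>T\<close> is Lipschitz. Differentiability almost everywhere then
  comes from Rademacher's theorem in dimension one, proved here by Vitali coverings.
\<close>

section \<open>Lipschitz functions of a real variable\<close>

lemma le_if_le_add_small:
  fixes x y C k\<^sub>0 :: real
  assumes "k\<^sub>0 > 0"
    and le: "\<And>k. 0 < k \<Longrightarrow> k < k\<^sub>0 \<Longrightarrow> x \<le> y + C * k"
  shows "x \<le> y"
proof -
  have "\<forall>\<^sub>F k in at_right 0. x \<le> y + C * k"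
    unfolding eventually_at_right_field using assms by blast
  moreover have "((\<lambda>k. y + C * k) \<longlongrightarrow> y + C * 0) (at_right 0)"
    by (intro tendsto_intros)
  ultimately show ?thesis
    using tendsto_lowerbound[of "\<lambda>k. y + C * k" "y + C * 0" "at_right 0" x] by simp
qed

text \<open>The short intervals supplied by \<open>fine\<close> form a Vitali cover of
  \<open>E\<close>, so countably many disjoint ones cover \<open>E\<close> up to a null set.
  Monotonicity carries them to non-overlapping intervals inside \<open>{g c..g d}\<close>, each at
  least \<open>q\<close> times as long as its source; summing gives the estimate.\<close>

lemma mono_increment_ge_measure:
  fixes g :: "real \<Rightarrow> real"
  assumes g: "mono_on {c..d} g" and E: "E \<in> lmeasurable" "E \<subseteq> {c<..<d}" and q: "q \<ge> 0"
    and cd: "c \<le> d"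
    and fine: "\<And>x \<delta>. x \<in> E \<Longrightarrow> \<delta> > 0 \<Longrightarrow>
      \<exists>u v. u \<le> x \<and> x \<le> v \<and> u < v \<and> v - u < \<delta> \<and> g v - g u \<ge> q * (v - u)"
  shows "q * measure lebesgue E \<le> g d - g c"
proof -
  define K
    where "K = {(u, v). c \<le> u \<and> u < v \<and> v \<le> d \<and> g v - g u \<ge> q * (v - u)}"
  define J where "J = (\<lambda>i::real \<times> real. {fst i..snd i})"
  have cb: "cball ((fst i + snd i) / 2) ((snd i - fst i) / 2) = J i" for i :: "real \<times> real"
    by (simp add: cball_eq_atLeastAtMost J_def field_simps)
  have *: "\<exists>i. i \<in> K \<and> x \<in> cball ((fst i + snd i) / 2) ((snd i - fst i) / 2) \<and> (snd i - fst i) / 2 < \<delta>"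
    if x: "x \<in> E" and \<delta>: "\<delta> > 0" for x \<delta>
  proof -
    have x': "c < x" "x < d" using x E by auto
    \<comment> \<open>The distances to \<open>c\<close> and \<open>d\<close> keep the chosen
      interval inside \<open>{c..d}\<close>.\<close>
    define \<epsilon> where "\<epsilon> = min \<delta> (min (x - c) (d - x))"
    have "\<epsilon> > 0" using x' \<delta> by (simp add: \<epsilon>_def)
    from fine[OF x this] obtain u v where uv: "u \<le> x" "x \<le> v" "u < v" "v - u < \<epsilon>"
      "g v - g u \<ge> q * (v - u)" by blast
    have "(u, v) \<in> K" "x \<in> J (u, v)" "(v - u) / 2 < \<delta>"
      using uv by (auto simp: K_def J_def \<epsilon>_def)
    then show ?thesis unfolding cb by force
  qed
  have pos: "0 < (snd i - fst i) / 2" if "i \<in> K" for i using that by (auto simp: K_def)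
  obtain C where C: "countable C" "C \<subseteq> K"
    and disj: "pairwise (\<lambda>i j. disjnt (J i) (J j)) C"
    and neg: "negligible (E - (\<Union>i\<in>C. J i))"
    using Vitali_covering_theorem_cballs[of K "\<lambda>i. (snd i - fst i) / 2" E "\<lambda>i. (fst i + snd i) / 2", OF pos *]
    unfolding cb by blast
  \<comment> \<open>Open images are taken because the images of disjoint intervals may share an
    endpoint.\<close>
  define G where "G = (\<lambda>i. {g (fst i)<..<g (snd i)})"
  have CK: "c \<le> fst i" "fst i < snd i" "snd i \<le> d" "g (snd i) - g (fst i) \<ge> q * (snd i - fst i)"
    if "i \<in> C" for i
    using that C(2) by (auto simp: K_def)
  have Gd: "disjoint_family_on G C"
  proof (unfold disjoint_family_on_def, intro ballI impI)
    fix i j assume ij: "i \<in> C" "j \<in> C" "i \<noteq> j"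
    then have "J i \<inter> J j = {}" using disj by (auto simp: pairwise_def disjnt_def)
    then have "snd i < fst j \<or> snd j < fst i"
      using CK[OF ij(1)] CK[OF ij(2)] unfolding J_def by (auto simp: max_def split: if_splits)
    then have "g (snd i) \<le> g (fst j) \<or> g (snd j) \<le> g (fst i)"
      using CK[OF ij(1)] CK[OF ij(2)] by (auto intro!: monotone_onD[OF g])
    then show "G i \<inter> G j = {}" unfolding G_def by auto
  qed
  have Jd: "disjoint_family_on J C"
    using disj by (auto simp: disjoint_family_on_def pairwise_def disjnt_def)
  have gcd: "g c \<le> g d" using cd by (auto intro!: monotone_onD[OF g])
  have "emeasure lebesgue E \<le> emeasure lebesgue ((\<Union>i\<in>C. J i) \<union> (E - (\<Union>i\<in>C. J i)))"
  proof (rule emeasure_mono)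
    have "(\<Union>i\<in>C. J i) \<in> sets lebesgue" using C(1)
      by (intro sets.countable_UN'') (auto simp: J_def)
    moreover have "E - (\<Union>i\<in>C. J i) \<in> sets lebesgue" using neg
      by (rule negligible_imp_sets)
    ultimately show "(\<Union>i\<in>C. J i) \<union> (E - (\<Union>i\<in>C. J i)) \<in> sets lebesgue"
      by blast
  qed auto
  also have "\<dots> = emeasure lebesgue (\<Union>i\<in>C. J i)"
  proof (rule emeasure_Un_null_set)
    show "(\<Union>i\<in>C. J i) \<in> sets lebesgue" using C(1)
      by (intro sets.countable_UN'') (auto simp: J_def)
    show "E - (\<Union>i\<in>C. J i) \<in> null_sets lebesgue" using neg
      by (simp add: negligible_iff_null_sets)
  qed
  also have "\<dots> = (\<integral>\<^sup>+i. emeasure lebesgue (J i) \<partial>count_space C)"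
    by (rule emeasure_UN_countable[OF _ C(1) Jd]) (auto simp: J_def)
  finally have "ennreal q * emeasure lebesgue E \<le> ennreal q * (\<integral>\<^sup>+i. emeasure lebesgue (J i) \<partial>count_space C)"
    by (rule mult_left_mono) simp
  also have "\<dots> = (\<integral>\<^sup>+i. ennreal q * emeasure lebesgue (J i) \<partial>count_space C)"
    by (rule nn_integral_cmult[symmetric]) simp
  also have "\<dots> \<le> (\<integral>\<^sup>+i. emeasure lebesgue (G i) \<partial>count_space C)"
  proof (rule nn_integral_mono)
    fix i assume "i \<in> space (count_space C)"
    then have i: "i \<in> C" by simp
    have "0 \<le> q * (snd i - fst i)" using CK[OF i] q by simp
    then have "g (fst i) \<le> g (snd i)" using CK[OF i] by linarith
    then show "ennreal q * emeasure lebesgue (J i) \<le> emeasure lebesgue (G i)"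
      using CK[OF i] q by (simp add: J_def G_def ennreal_mult[symmetric] ennreal_leI)
  qed
  also have "\<dots> = emeasure lebesgue (\<Union>i\<in>C. G i)"
    by (rule emeasure_UN_countable[OF _ C(1) Gd, symmetric]) (auto simp: G_def)
  also have "\<dots> \<le> emeasure lebesgue {g c..g d}"
  proof (rule emeasure_mono)
    have "g c \<le> g (fst i)" "g (snd i) \<le> g d" if "i \<in> C" for i
      using CK[OF that] by (auto intro!: monotone_onD[OF g])
    then show "(\<Union>i\<in>C. G i) \<subseteq> {g c..g d}" unfolding G_def by fastforce
  qed auto
  also have "\<dots> = ennreal (g d - g c)" using gcd by simp
  also have "ennreal q * emeasure lebesgue E = ennreal (q * measure lebesgue E)"
    using E(1) q by (simp add: emeasure_eq_measure2 ennreal_mult)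
  finally show ?thesis using gcd by (simp add: ennreal_le_iff)
qed

text \<open>The growth estimate is applied to \<open>M * x - f x\<close>: off \<open>N\<close> this
  function has difference quotients at least \<open>M - e\<close> over arbitrarily short intervals.
  Comparing its total increment with \<open>(M - e) * (d - c)\<close> leaves
  \<open>f d - f c \<le> e * (d - c)\<close>, and \<open>e\<close> tends to
  \<open>0\<close>.\<close>

lemma lipschitz_AE_deriv_nonpos_imp_le:
  fixes f :: "real \<Rightarrow> real"
  assumes f: "K-lipschitz_on {c..d} f" and cd: "c \<le> d" and N: "negligible N"
    and D: "\<And>x. x \<in> {c<..<d} - N \<Longrightarrow> \<exists>D\<le>0. (f has_real_derivative D) (at x)"
  shows "f d \<le> f c"
proof -
  \<comment> \<open>Slope \<open>K\<close> would already make \<open>g\<close> monotone; the extra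
    \<open>1\<close> makes \<open>M - e\<close> nonnegative for every \<open>e < 1\<close>.\<close>
  define M where "M = K + 1"
  have K: "K \<ge> 0" using f by (rule lipschitz_on_nonneg)
  define g where "g = (\<lambda>x. M * x - f x)"
  have mono: "mono_on {c..d} g"
  proof (rule monotone_onI)
    fix x y assume xy: "x \<in> {c..d}" "y \<in> {c..d}" "x \<le> y"
    have "f y - f x \<le> K * (y - x)"
      using lipschitz_onD[OF f xy(1,2)] xy(3) by (auto simp: dist_real_def abs_if split: if_splits)
    also have "\<dots> \<le> M * (y - x)" using xy(3) by (intro mult_right_mono) (simp_all add: M_def)
    finally show "g x \<le> g y" by (simp add: g_def algebra_simps)
  qed
  have "f d - f c \<le> e * (d - c)" if e: "0 < e" "e < 1" for e
  proof -
    define E where "E = {c<..<d} - N"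
    have E: "E \<in> lmeasurable" "measure lebesgue E = d - c"
      using N cd by (simp_all add: E_def measurable_measure_Diff negligible_imp_measurable
          measure_Diff_null_set negligible_iff_null_sets fmeasurable.Diff  null_setsD2)
    have "(M - e) * measure lebesgue E \<le> g d - g c"
    proof (rule mono_increment_ge_measure[OF mono E(1) _ _ cd])
      show "E \<subseteq> {c<..<d}" "0 \<le> M - e" using e K by (auto simp: E_def M_def)
      fix x \<delta> :: real assume x: "x \<in> E" and \<delta>: "\<delta> > 0"
      obtain D where D: "D \<le> 0" "(f has_real_derivative D) (at x)" using D x unfolding E_def by blast
      have "((\<lambda>x. f x - e * x) has_real_derivative D - e) (at x)"
        using D(2) by (auto intro!: derivative_eq_intros)
      from has_real_derivative_neg_dec_right[OF this] D(1) e
      obtain \<eta> where \<eta>: "\<eta> > 0"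
        "\<And>h. 0 < h \<Longrightarrow> h < \<eta> \<Longrightarrow> f (x + h) - e * (x + h) < f x - e * x"
          by auto
      define h where "h = min \<eta> \<delta> / 2"
      have h: "0 < h" "h < \<eta>" "h < \<delta>" using \<eta> \<delta> by (auto simp: h_def)
      show "\<exists>u v. u \<le> x \<and> x \<le> v \<and> u < v \<and> v - u < \<delta> \<and> (M - e) * (v - u) \<le> g v - g u"
        by (rule exI[of _ x], rule exI[of _ "x + h"]) (use h \<eta>(2)[OF h(1,2)] in \<open>simp add: g_def algebra_simps\<close>)
    qed
    then show ?thesis unfolding E(2) g_def by (simp add: algebra_simps)
  qed
  then have "f d - f c \<le> 0"
    by (intro le_if_le_add_small[of 1 _ 0 "d - c"]) (simp_all add: mult.commute)
  then show ?thesis by simp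
qed

section \<open>Almost everywhere differentiability of Lipschitz functions\<close>

text \<open>Take an open \<open>W\<close> around \<open>E\<close> whose measure exceeds that of
  \<open>E\<close> by at most \<open>e\<close>. Disjoint Vitali balls inside \<open>W\<close> cover
  \<open>E\<close> up to a null set, and summing the density bound over them shows that the measure
  \<open>m\<close> of \<open>E\<close> satisfies \<open>m \<le> \<theta> * (m + e)\<close>. As
  \<open>e\<close> tends to \<open>0\<close>, this forces \<open>m = 0\<close>.\<close>

lemma negligible_if_interval_density_less:
  fixes E :: "real set"
  assumes E: "E \<in> lmeasurable" "E \<subseteq> {a<..<b}" and \<theta>: "0 \<le> \<theta>"
    "\<theta> < 1"
    and le: "\<And>c d. a \<le> c \<Longrightarrow> c \<le> d \<Longrightarrow> d \<le> b \<Longrightarrow> measure lebesgue (E \<inter> {c<..<d}) \<le> \<theta> * (d - c)"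
  shows "negligible E"
proof -
  have "measure lebesgue E \<le> \<theta> * (measure lebesgue E + e)" if e: "e > 0" for e
  proof -
    obtain T where T: "open T" "E \<subseteq> T" "T - E \<in> lmeasurable"
      "emeasure lebesgue (T - E) < ennreal e"
      using sets_lebesgue_outer_open[of E e] E(1) e by blast
    \<comment> \<open>Cutting down to \<open>{a<..<b}\<close> keeps every ball in the range where
      the density hypothesis applies.\<close>
    define W where "W = T \<inter> {a<..<b}"
    have W: "open W" "E \<subseteq> W" "W \<subseteq> {a<..<b}" using T E by (auto simp: W_def)
    have We: "emeasure lebesgue W \<le> ennreal (measure lebesgue E + e)"
    proof -
      have "emeasure lebesgue W \<le> emeasure lebesgue (E \<union> (T - E))"
        by (rule emeasure_mono) (use T E in \<open>auto simp: W_def\<close>)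
      also have "\<dots> \<le> emeasure lebesgue E + emeasure lebesgue (T - E)"
        by (rule emeasure_subadditive) (use T E in auto)
      also have "\<dots> \<le> ennreal (measure lebesgue E) + ennreal e"
        using T(4) E(1) by (intro add_mono) (auto simp: emeasure_eq_measure2)
      finally show ?thesis using e by simp
    qed
    define K where "K = {i::real \<times> real. snd i > 0 \<and> ball (fst i) (snd i) \<subseteq> W}"
    have *: "\<exists>i. i \<in> K \<and> x \<in> ball (fst i) (snd i) \<and> snd i < \<delta>"
      if x: "x \<in> E" and \<delta>: "\<delta> > 0" for x \<delta>
    proof -
      obtain r where r: "r > 0" "ball x r \<subseteq> W" using W x open_contains_ball by blast
      have "(x, min r (\<delta> / 2)) \<in> K" "x \<in> ball x (min r (\<delta> / 2))"
        "min r (\<delta> / 2) < \<delta>"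
        using r \<delta> subset_ball[of "min r (\<delta> / 2)" r x] by (auto simp: K_def)
      then show ?thesis by (intro exI[of _ "(x, min r (\<delta> / 2))"]) simp
    qed
    obtain C where C: "countable C" "C \<subseteq> K"
      and disj: "pairwise (\<lambda>i j. disjnt (ball (fst i) (snd i)) (ball (fst j) (snd j))) C"
      and neg: "negligible (E - (\<Union>i\<in>C. ball (fst i) (snd i)))"
      using Vitali_covering_theorem_balls[of E K fst snd, OF *] by blast
    define J where "J = (\<lambda>i::real \<times> real. ball (fst i) (snd i))"
    have Jd: "disjoint_family_on J C"
      using disj by (simp add: disjoint_family_on_def pairwise_def disjnt_def J_def)
    then have Jd': "disjoint_family_on (\<lambda>i. E \<inter> J i) C"
      unfolding disjoint_family_on_def by blast
    have ms: "(\<Union>i\<in>C. E \<inter> J i) \<in> sets lebesgue" using C(1) E(1)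
      by (intro sets.countable_UN'') (auto simp: J_def)
    have "emeasure lebesgue E \<le> emeasure lebesgue ((\<Union>i\<in>C. E \<inter> J i) \<union> (E - (\<Union>i\<in>C. J i)))"
      using ms neg[THEN negligible_imp_sets] by (intro emeasure_mono) (auto simp: J_def)
    also have "\<dots> = emeasure lebesgue (\<Union>i\<in>C. E \<inter> J i)"
      using ms neg by (intro emeasure_Un_null_set) (simp_all add: J_def negligible_iff_null_sets)
    also have "\<dots> = (\<integral>\<^sup>+i. emeasure lebesgue (E \<inter> J i) \<partial>count_space C)"
      using E(1) by (intro emeasure_UN_countable[OF _ C(1) Jd']) (auto simp: J_def)
    also have "\<dots> \<le> (\<integral>\<^sup>+i. ennreal \<theta> * emeasure lebesgue (J i) \<partial>count_space C)"
    proof (rule nn_integral_mono)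
      fix i assume "i \<in> space (count_space C)"
      then have i: "snd i > 0" "J i \<subseteq> W" using C(2) by (auto simp: K_def J_def)
      obtain c d where cd: "J i = {c<..<d}" "c < d"
        using i(1) by (simp add: J_def ball_eq_greaterThanLessThan) 
      have "a \<le> c" "d \<le> b"
        using i(2) W(3) cd greaterThanLessThan_subseteq_greaterThanLessThan[of c d a b] by auto
      then have "measure lebesgue (E \<inter> J i) \<le> \<theta> * (d - c)" unfolding cd(1)
        using le cd(2) by simp
      moreover have "E \<inter> J i \<in> lmeasurable" using E(1) unfolding cd(1)
        by (intro fmeasurable.Int) auto
      ultimately show "emeasure lebesgue (E \<inter> J i) \<le> ennreal \<theta> * emeasure lebesgue (J i)"
        using cd(2) \<theta>(1) unfolding cd(1)
          by (simp add: emeasure_eq_measure2 ennreal_mult[symmetric] ennreal_leI)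
    qed
    also have "\<dots> = ennreal \<theta> * (\<integral>\<^sup>+i. emeasure lebesgue (J i) \<partial>count_space C)"
      by (rule nn_integral_cmult) simp
    also have "\<dots> = ennreal \<theta> * emeasure lebesgue (\<Union>i\<in>C. J i)"
      by (subst emeasure_UN_countable[OF _ C(1) Jd]) (auto simp: J_def)
    also have "\<dots> \<le> ennreal \<theta> * emeasure lebesgue W"
      using C(2) W(1) by (intro mult_left_mono emeasure_mono) (auto simp: J_def K_def)
    also have "\<dots> \<le> ennreal \<theta> * ennreal (measure lebesgue E + e)"
      using We by (intro mult_left_mono) auto
    also have "\<dots> = ennreal (\<theta> * (measure lebesgue E + e))"
      using \<theta>(1) e by (intro ennreal_mult[symmetric]) auto
    also have "emeasure lebesgue E = ennreal (measure lebesgue E)"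
      using E(1) by (simp add: emeasure_eq_measure2)
    finally show ?thesis
      by (rule ennreal_le_iff[THEN iffD1, rotated]) (use \<theta>(1) e in simp)
  qed
  then have "measure lebesgue E \<le> \<theta> * measure lebesgue E + \<theta> * e" if "e > 0" for e
    using that unfolding distrib_left[symmetric] by blast
  then have "measure lebesgue E \<le> \<theta> * measure lebesgue E"
    using le_if_le_add_small[of 1] zero_less_one by blast
  then have "(1 - \<theta>) * measure lebesgue E \<le> 0" by (simp add: algebra_simps)
  then have "measure lebesgue E = 0"
    using \<theta>(2) mult_le_0_iff[of "1 - \<theta>" "measure lebesgue E"] measure_nonneg[of lebesgue E]
      by linarith
  then show ?thesis using E(1) by (simp add: negligible_iff_measure)
qed


text \<open>Where differentiability fails, rationals \<open>p < q\<close> separate the lower and the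
  upper derivative, both taken over short intervals around \<open>x\<close>. On such a set
  \<open>g\<close> grows at rate at least \<open>q\<close> and \<open>R * x - g x\<close> at rate at
  least \<open>R - p\<close>. Adding the two growth estimates bounds the density of the set in every
  interval by \<open>R / (R + q - p) < 1\<close>, so it is null.\<close>

lemma lipschitz_mono_AE_differentiable:
  fixes g :: "real \<Rightarrow> real"
  assumes mono: "mono_on {a..b} g" and R: "R \<ge> 0"
    and lip: "\<And>x y. a \<le> x \<Longrightarrow> x \<le> y \<Longrightarrow> y \<le> b \<Longrightarrow> g y - g x \<le> R * (y - x)"
  shows "negligible {x \<in> {a<..<b}. \<not> g differentiable at x}"
proof -
  \<comment> \<open>For fixed \<open>u\<close> and \<open>v\<close> the strict inequalities make the
    admissible \<open>x\<close> an open set, so \<open>U q\<close> and \<open>V p\<close> are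
    G-delta sets and thus measurable.\<close>
  define near
    where "near = (\<lambda>x n u v. a \<le> u \<and> u < x \<and> x < v \<and> v \<le> b \<and> v - u < inverse (real (Suc n)))"
  define U
    where "U = (\<lambda>q. {x. \<forall>n. \<exists>u v. near x n u v \<and> g v - g u > q * (v - u)})"
  define V
    where "V = (\<lambda>p. {x. \<forall>n. \<exists>u v. near x n u v \<and> g v - g u < p * (v - u)})"
  have G_delta: "{x. \<forall>n. \<exists>u v. near x n u v \<and> P u v} \<in> sets lebesgue" for P
  proof -
    have "{x. \<forall>n. \<exists>u v. near x n u v \<and> P u v}
      = (\<Inter>n. \<Union>u\<in>{a..}. \<Union>v\<in>{v. v \<le> b \<and> v - u < inverse (real (Suc n)) \<and> P u v}. {u<..<v})"
      unfolding set_eq_iff near_def INT_iff UN_iff greaterThanLessThan_iff mem_Collect_eq atLeast_iff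
        by blast
    also have "\<dots> \<in> sets borel"
      by (intro sets.countable_INT'' borel_open open_UN) auto
    finally show ?thesis by simp
  qed
  have short: "\<exists>n. inverse (real (Suc n)) < \<delta>" if "\<delta> > 0" for \<delta> :: real
    using reals_Archimedean[OF that] .
  have null: "negligible (U q \<inter> V p)" if pq: "0 \<le> p" "p < q" "q \<le> R" for p q
  proof (cases "a < b")
    case False
    then have "U q = {}" by (auto simp: U_def near_def)
    then show ?thesis by simp
  next
    case True
    define E where "E = U q \<inter> V p"
    have Eab: "E \<subseteq> {a<..<b}" by (auto simp: E_def U_def near_def)
    have E: "E \<in> lmeasurable"
    proof (rule fmeasurableI2)
      show "{a<..<b} \<in> lmeasurable" "E \<subseteq> {a<..<b}" using Eab by auto
      show "E \<in> sets lebesgue" unfolding E_def U_def V_def using G_delta by (intro sets.Int)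
    qed
    have le: "(R + q - p) * measure lebesgue (E \<inter> {c<..<d}) \<le> R * (d - c)"
      if cd: "a \<le> c" "c \<le> d" "d \<le> b" for c d
    proof -
      let ?F = "E \<inter> {c<..<d}"
      have F: "?F \<in> lmeasurable" "?F \<subseteq> {c<..<d}" using E by (auto intro!: fmeasurable.Int)
      have sub: "{c..d} \<subseteq> {a..b}" using cd by auto
      have "q * measure lebesgue ?F \<le> g d - g c"
      proof (rule mono_increment_ge_measure[OF _ F _ cd(2)])
        show "mono_on {c..d} g" using mono sub by (rule mono_on_subset)
        fix x \<delta> :: real assume x: "x \<in> ?F" and \<delta>: "\<delta> > 0"
        obtain n where n: "inverse (real (Suc n)) < \<delta>" using short[OF \<delta>] by blast
        obtain u v where "near x n u v" "g v - g u > q * (v - u)" using x unfolding E_def U_def by blast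
        then show "\<exists>u v. u \<le> x \<and> x \<le> v \<and> u < v \<and> v - u < \<delta> \<and> q * (v - u) \<le> g v - g u"
          using n by (intro exI[of _ u] exI[of _ v]) (auto simp: near_def)
      qed (use pq in auto)
      \<comment> \<open>Passing to \<open>R * x - g x\<close> turns slopes below \<open>p\<close>
        into slopes above \<open>R - p\<close>.\<close>
      moreover have "(R - p) * measure lebesgue ?F \<le> (R * d - g d) - (R * c - g c)"
      proof (rule mono_increment_ge_measure[OF _ F _ cd(2), where g = "\<lambda>x. R * x - g x"])
        show "mono_on {c..d} (\<lambda>x. R * x - g x)"
        proof (rule monotone_onI)
          fix x y assume "x \<in> {c..d}" "y \<in> {c..d}" "x \<le> y"
          then show "R * x - g x \<le> R * y - g y" using lip[of x y] cd by (simp add: algebra_simps)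
        qed
        fix x \<delta> :: real assume x: "x \<in> ?F" and \<delta>: "\<delta> > 0"
        obtain n where n: "inverse (real (Suc n)) < \<delta>" using short[OF \<delta>] by blast
        obtain u v where "near x n u v" "g v - g u < p * (v - u)" using x unfolding E_def V_def by blast
        then show "\<exists>u v. u \<le> x \<and> x \<le> v \<and> u < v \<and> v - u < \<delta> \<and> (R - p) * (v - u) \<le> R * v - g v - (R * u - g u)"
          using n by (intro exI[of _ u] exI[of _ v]) (auto simp: near_def algebra_simps)
      qed (use pq in auto)
      ultimately show ?thesis by (simp add: algebra_simps)
    qed
    have "negligible E"
    proof (rule negligible_if_interval_density_less[OF E Eab])
      show "0 \<le> R / (R + q - p)" "R / (R + q - p) < 1" using pq R by (simp_all add: field_simps)
      fix c d assume "a \<le> c" "c \<le> d" "d \<le> b"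
      from le[OF this] show "measure lebesgue (E \<inter> {c<..<d}) \<le> R / (R + q - p) * (d - c)"
        using pq R by (simp add: pos_le_divide_eq mult.commute)
    qed
    then show ?thesis by (simp add: E_def)
  qed
  define Z
    where "Z = (\<Union>p\<in>\<rat> \<inter> {0..R}. \<Union>q\<in>\<rat> \<inter> {p<..R}. U q \<inter> V p)"
  have "negligible Z" unfolding Z_def
negligible_iff_null_sets
    by (intro null_sets_UN' countable_Int1 countable_rat) (auto simp: negligible_iff_null_sets[symmetric] intro: null)
  moreover have "g differentiable at x" if x: "x \<in> {a<..<b}" "x \<notin> Z" for x
  proof -
    \<comment> \<open>\<open>S\<close> collects the eventual upper bounds for slopes over short
      intervals around \<open>x\<close>, so \<open>D = Inf S\<close> is the upper derivative. It
      remains to see that the lower one agrees.\<close>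
    define S where "S = {r. x \<notin> U r}"
    have inc: "0 \<le> g v - g u" "g v - g u \<le> R * (v - u)" if "a \<le> u" "u \<le> v" "v \<le> b"
      for u v
      using monotone_onD[OF mono, of u v] lip[of u v] that by auto
    have "\<not> R * (v - u) < g v - g u" if "near x n u v" for n u v
      using inc(2)[of u v] that by (simp add: near_def)
    then have RS: "R \<in> S" by (auto simp: S_def U_def)
    have S0: "r \<ge> 0" if "r \<in> S" for r
    proof (rule ccontr)
      assume "\<not> 0 \<le> r"
      then have r: "r < 0" by simp
      obtain n where n: "\<And>u v. near x n u v \<Longrightarrow> g v - g u \<le> r * (v - u)"
        using \<open>r \<in> S\<close> by (force simp: S_def U_def not_less)
      define k where "k = min (inverse (real (Suc n)) / 4) (min (x - a) (b - x))"
      have "k > 0" using x unfolding k_def by simp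
      moreover have "k \<le> inverse (real (Suc n)) / 4" unfolding k_def by (rule min.cobounded1)
      moreover have "k \<le> min (x - a) (b - x)" unfolding k_def by (rule min.cobounded2)
      moreover have "inverse (real (Suc n)) > 0" by simp
      ultimately have k: "k > 0" "2 * k < inverse (real (Suc n))" "k \<le> x - a" "k \<le> b - x"
        by linarith+
      have "near x n (x - k) (x + k)" unfolding near_def using k by auto
      from n[OF this] have "g (x + k) - g (x - k) \<le> r * (2 * k)" by simp
      moreover have "0 \<le> g (x + k) - g (x - k)" using k by (intro inc(1)) auto
      ultimately have "0 \<le> r * (2 * k)" by linarith
      then show False using r k(1) by (simp add: zero_le_mult_iff)
    qed
    define D where "D = Inf S"
    have bdd: "bdd_below S" using S0 by (auto simp: bdd_below_def)
    have DR: "D \<le> R" unfolding D_def by (rule cInf_lower[OF RS bdd])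
    have key: "\<exists>n. \<forall>u v. near x n u v \<longrightarrow> (D - e) * (v - u) \<le> g v - g u \<and> g v - g u \<le> (D + e) * (v - u)"
      if e: "e > 0" for e
    proof -
      have "Inf S < D + e" using e by (simp add: D_def)
      then obtain r where r: "r \<in> S" "r < D + e" using cInf_lessD[of S] RS by blast
      then obtain n1 where n1: "\<And>u v. near x n1 u v \<Longrightarrow> g v - g u \<le> r * (v - u)"
        by (force simp: S_def U_def not_less)
      have up: "g v - g u \<le> (D + e) * (v - u)" if "near x n1 u v" for u v
      proof -
        have "r * (v - u) \<le> (D + e) * (v - u)" using r that
          by (intro mult_right_mono) (auto simp: near_def)
        then show ?thesis using n1[OF that] by linarith
      qed
      \<comment> \<open>A negative \<open>D - e\<close> is a lower bound by monotonicity. Otherwise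
        there are rationals \<open>D - e < p < q < D\<close>; \<open>q\<close> lies below
        \<open>Inf S\<close>, so \<open>x \<in> U q\<close>, and \<open>x \<notin> Z\<close> then
        excludes \<open>x \<in> V p\<close>.\<close>
      have "\<exists>n2. \<forall>u v. near x n2 u v \<longrightarrow> (D - e) * (v - u) \<le> g v - g u"
      proof (cases "D - e < 0")
        case True
        have "(D - e) * (v - u) \<le> g v - g u" if "near x 0 u v" for u v
        proof -
          have "(D - e) * (v - u) \<le> 0" using True that
            by (intro mult_nonpos_nonneg) (auto simp: near_def)
          then show ?thesis using inc(1)[of u v] that by (auto simp: near_def)
        qed
        then show ?thesis by blast
      next
        case False
        obtain p where p: "p \<in> \<rat>" "D - e < p" "p < D" using Rats_dense_in_real[of "D - e" D] e
          by auto
        obtain q where q: "q \<in> \<rat>" "p < q" "q < D" using Rats_dense_in_real[of p D] p by auto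
        have "q \<notin> S" using cInf_lower[OF _ bdd, of q] q by (auto simp: D_def)
        then have "x \<in> U q" by (simp add: S_def)
        moreover have "p \<in> \<rat> \<inter> {0..R}" "q \<in> \<rat> \<inter> {p<..R}"
          using p q False DR by auto
        ultimately have "x \<notin> V p" using x(2) unfolding Z_def by blast
        then obtain n2 where n2: "\<And>u v. near x n2 u v \<Longrightarrow> p * (v - u) \<le> g v - g u"
          by (force simp: V_def not_less)
        have "(D - e) * (v - u) \<le> g v - g u" if "near x n2 u v" for u v
        proof -
          have "(D - e) * (v - u) \<le> p * (v - u)" using p that
            by (intro mult_right_mono) (auto simp: near_def)
          then show ?thesis using n2[OF that] by linarith
        qed
        then show ?thesis by blast
      qed
      then obtain n2
        where n2: "\<And>u v. near x n2 u v \<Longrightarrow> (D - e) * (v - u) \<le> g v - g u" by blast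
      have anti: "near x m u v" if "near x n u v" "m \<le> n" for m n u v
      proof -
        have "inverse (real (Suc n)) \<le> inverse (real (Suc m))" using that(2)
          by (intro le_imp_inverse_le) auto
        then show ?thesis using that(1) unfolding near_def by linarith
      qed
      show ?thesis
        by (rule exI[of _ "max n1 n2"]) (use up n2 anti in \<open>meson max.cobounded1 max.cobounded2\<close>)
    qed
    \<comment> \<open>Difference quotients at \<open>x\<close> use intervals with endpoint
      \<open>x\<close>, while \<open>near\<close> wants \<open>x\<close> strictly inside. Intervals
      are therefore enlarged by \<open>k\<close> on both sides and \<open>k\<close> tends to
      \<open>0\<close>; monotonicity and the Lipschitz bound control the change of
      \<open>g\<close>.\<close>
    have weak: "\<exists>\<delta>>0. \<forall>u v. u \<le> x \<and> x \<le> v \<and> v - u < \<delta> \<longrightarrow> \<bar>g v - g u - D * (v - u)\<bar> \<le> e * (v - u)"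
      if e: "e > 0" for e
    proof -
      obtain n where n: "\<And>u v. near x n u v \<Longrightarrow> (D - e) * (v - u) \<le> g v - g u"
         "\<And>u v. near x n u v \<Longrightarrow> g v - g u \<le> (D + e) * (v - u)" using key[OF e]
           by blast
      \<comment> \<open>The factor one half is for the enlargement: adding
        \<open>k < \<delta> / 2\<close> on each side keeps the length below
        \<open>2 * \<delta>\<close>.\<close>
      define \<delta> where "\<delta> = min (inverse (real (Suc n))) (min (x - a) (b - x)) / 2"
      have "\<delta> > 0" using x unfolding \<delta>_def by simp
      moreover have "2 * \<delta> \<le> inverse (real (Suc n))" "2 * \<delta> \<le> min (x - a) (b - x)"
        unfolding \<delta>_def by (simp_all only: times_divide_eq_right nonzero_mult_div_cancel_left
            zero_neq_numeral[symmetric] not_False_eq_True min.cobounded1 min.cobounded2)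
      ultimately have \<delta>: "\<delta> > 0" "2 * \<delta> \<le> inverse (real (Suc n))"
        "2 * \<delta> \<le> x - a" "2 * \<delta> \<le> b - x"
        by linarith+
      have "\<bar>g v - g u - D * (v - u)\<bar> \<le> e * (v - u)" if uv: "u \<le> x" "x \<le> v"
        "v - u < \<delta>" for u v
      proof -
        have wide: "near x n (u - k) (v + k)" "a \<le> u - k" "v + k \<le> b" if "0 < k"
          "k < \<delta> / 2" for k
          using that uv \<delta> by (auto simp: near_def)
        have "g v - g u \<le> (D + e) * (v - u)"
        proof (rule le_if_le_add_small[of "\<delta> / 2" _ _ "2 * (D + e)"])
          fix k assume k: "0 < k" "k < \<delta> / 2"
          have "g v \<le> g (v + k)" "g (u - k) \<le> g u"
            using inc(1)[of v "v + k"] inc(1)[of "u - k" u] wide[OF k] k(1) uv x by auto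
          then show "g v - g u \<le> (D + e) * (v - u) + 2 * (D + e) * k"
            using n(2)[OF wide(1)[OF k]] by (simp add: algebra_simps)
        qed (use \<delta> in auto)
        moreover have "(D - e) * (v - u) \<le> g v - g u"
        proof (rule le_if_le_add_small[of "\<delta> / 2" _ _ "2 * R - 2 * (D - e)"])
          fix k assume k: "0 < k" "k < \<delta> / 2"
          have "g (v + k) - g v \<le> R * k" "g u - g (u - k) \<le> R * k"
            using inc(2)[of v "v + k"] inc(2)[of "u - k" u] wide[OF k] k(1) uv x by auto
          then show "(D - e) * (v - u) \<le> g v - g u + (2 * R - 2 * (D - e)) * k"
            using n(1)[OF wide(1)[OF k]] by (simp add: algebra_simps)
        qed (use \<delta> in auto)
        ultimately show ?thesis by (simp add: abs_le_iff algebra_simps)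
      qed
      then show ?thesis using \<delta>(1) by blast
    qed
    have "(g has_derivative (\<lambda>h. D * h)) (at x)"
      unfolding has_derivative_at_alt
    proof (intro conjI allI impI bounded_linear_mult_right)
      fix e :: real assume "0 < e"
      from weak[OF this] obtain \<delta> where \<delta>: "\<delta> > 0"
        "\<And>u v. u \<le> x \<Longrightarrow> x \<le> v \<Longrightarrow> v - u < \<delta> \<Longrightarrow> \<bar>g v - g u - D * (v - u)\<bar> \<le> e * (v - u)"
          by blast
      have "\<bar>g y - g x - D * (y - x)\<bar> \<le> e * \<bar>y - x\<bar>"
        if y: "\<bar>y - x\<bar> < \<delta>" for y
      proof (cases "x \<le> y")
        case True
        then show ?thesis using \<delta>(2)[of x y] y by simp
      next
        case False
        then have "\<bar>g x - g y - D * (x - y)\<bar> \<le> e * (x - y)" using \<delta>(2)[of y x] y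
          by simp
        moreover have "\<bar>g y - g x - D * (y - x)\<bar> = \<bar>g x - g y - D * (x - y)\<bar>"
          by (subst abs_minus_cancel[symmetric]) (simp add: algebra_simps)
        ultimately show ?thesis using False by simp
      qed
      then show "\<exists>d>0. \<forall>y. norm (y - x) < d \<longrightarrow> norm (g y - g x - D * (y - x)) \<le> e * norm (y - x)"
        using \<delta>(1) by auto
    qed
    then show ?thesis by (auto simp: differentiable_def)
  qed
  then have "{x \<in> {a<..<b}. \<not> g differentiable at x} \<subseteq> Z" by blast
  ultimately show ?thesis using negligible_subset by blast
qed

text \<open>Each coordinate plus \<open>K * x\<close> is monotone with slopes at most
  \<open>2 * K\<close>, so the monotone case applies coordinatewise.\<close>

theorem lipschitz_AE_differentiable:
  fixes f :: "real \<Rightarrow> 'a::euclidean_space"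
  assumes f: "K-lipschitz_on {a..b} f"
  shows "negligible {x \<in> {a<..<b}. \<not> f differentiable at x}"
proof -
  have K: "K \<ge> 0" using f by (rule lipschitz_on_nonneg)
  have "negligible {x \<in> {a<..<b}. \<not> (\<lambda>x. f x \<bullet> i) differentiable at x}"
    if i: "i \<in> Basis" for i
  proof -
    define g where "g = (\<lambda>x. f x \<bullet> i + K * x)"
    have *: "\<bar>f y \<bullet> i - f x \<bullet> i\<bar> \<le> K * (y - x)" if "a \<le> x" "x \<le> y"
      "y \<le> b" for x y
    proof -
      have "\<bar>f y \<bullet> i - f x \<bullet> i\<bar> \<le> norm (f y - f x)"
        using Basis_le_norm[OF i, of "f y - f x"] by (simp add: inner_diff_left)
      also have "\<dots> \<le> K * (y - x)" using lipschitz_onD[OF f, of y x] that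
        by (simp add: dist_norm)
      finally show ?thesis .
    qed
    have "negligible {x \<in> {a<..<b}. \<not> g differentiable at x}"
    proof (rule lipschitz_mono_AE_differentiable)
      show "mono_on {a..b} g"
      proof (rule monotone_onI)
        fix x y assume "x \<in> {a..b}" "y \<in> {a..b}" "x \<le> y"
        then show "g x \<le> g y" using *[of x y] by (simp add: g_def abs_le_iff algebra_simps)
      qed
      show "0 \<le> 2 * K" using K by simp
      fix x y assume "a \<le> x" "x \<le> y" "y \<le> b"
      from *[OF this] show "g y - g x \<le> 2 * K * (y - x)"
        by (simp add: g_def abs_le_iff algebra_simps)
    qed
    moreover have "(\<lambda>x. f x \<bullet> i) differentiable at x" if "g differentiable at x" for x
    proof -
      have "(\<lambda>x. g x - K * x) differentiable at x" using that by (intro derivative_intros) auto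
      then show ?thesis by (simp add: g_def)
    qed
    ultimately show ?thesis by (elim negligible_subset) blast
  qed
  then have "negligible (\<Union>i\<in>Basis. {x \<in> {a<..<b}. \<not> (\<lambda>x. f x \<bullet> i) differentiable at x})"
    by (intro negligible_Union) auto
  moreover have "{x \<in> {a<..<b}. \<not> f differentiable at x} \<subseteq> (\<Union>i\<in>Basis. {x \<in> {a<..<b}. \<not> (\<lambda>x. f x \<bullet> i) differentiable at x})"
    using differentiable_componentwise_within[of f _ UNIV] by auto
  ultimately show ?thesis by (rule negligible_subset)
qed

section \<open>Null sets, essential bounds and filters\<close>

lemma AE_lebesgue_onE:
  assumes "AE x in lebesgue_on S. P x" "S \<in> sets lebesgue"
  obtains N where "negligible N" "\<And>x. x \<in> S - N \<Longrightarrow> P x"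
proof -
  have "AE x in lebesgue. x \<in> S \<longrightarrow> P x"
    using assms by (simp add: AE_restrict_space_iff)
  then obtain N where "N \<in> null_sets lebesgue"
    "{x \<in> space lebesgue. \<not> (x \<in> S \<longrightarrow> P x)} \<subseteq> N"
    unfolding eventually_ae_filter by blast
  then show thesis using that[of N] by (auto simp: negligible_iff_null_sets)
qed

lemma AE_lebesgue_onI:
  assumes "negligible N" "\<And>x. x \<in> S - N \<Longrightarrow> P x" "S \<in> sets lebesgue"
  shows "AE x in lebesgue_on S. P x"
proof -
  have "AE x in lebesgue. x \<in> S \<longrightarrow> P x"
    by (rule AE_I'[of N]) (use assms in \<open>auto simp: negligible_iff_null_sets\<close>)
  then show ?thesis using assms(3) by (simp add: AE_restrict_space_iff)
qed

text \<open>Both essential bounds hold at almost every point, and for a nonzero measure such a point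
  exists.\<close>

lemma essinf_le_esssup:
  fixes M :: "'a measure" and f :: "'a \<Rightarrow> ereal"
  assumes "emeasure M (space M) \<noteq> 0"
  shows "essinf M f \<le> esssup M f"
proof -
  have "AE x in M. essinf M f \<le> esssup M f"
    using esssup_AE[of f M] esssup_AE[of "\<lambda>x. - f x" M]
  proof eventually_elim
    case (elim x)
    then have "- esssup M (\<lambda>x. - f x) \<le> f x" by (simp add: ereal_uminus_le_reorder)
    then show ?case using elim(1) unfolding essinf_def by (rule order_trans)
  qed
  moreover have "ae_filter M \<noteq> bot" using assms by (simp add: ae_filter_eq_bot_iff)
  ultimately show ?thesis by simp
qed

text \<open>The filter \<open>at t\<close> omits the point \<open>t\<close>, whereas tangency of
  circles is tested there too; \<open>P t\<close> bridges the two.\<close>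

lemma near_iff_eventually_within:
  fixes t :: real
  assumes "P t"
  shows "(\<exists>\<delta>>0. \<forall>s\<in>{t - \<delta><..<t + \<delta>} \<inter> S. P s) \<longleftrightarrow> (\<forall>\<^sub>F s in at t within S. P s)"
  unfolding eventually_at
proof (intro ex_cong conj_cong refl)
  fix \<delta> :: real
  have "s \<in> {t - \<delta><..<t + \<delta>} \<longleftrightarrow> dist s t < \<delta>" for s
    by (auto simp: dist_real_def)
  then show "(\<forall>s\<in>{t - \<delta><..<t + \<delta>} \<inter> S. P s) \<longleftrightarrow> (\<forall>s\<in>S. s \<noteq> t \<and> dist s t < \<delta> \<longrightarrow> P s)"
    using assms by (metis Int_iff)
qed

lemma cot_surj: "\<exists>r. 0 < r \<and> r < pi \<and> cot r = (k::real)"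
proof (intro exI conjI)
  show "0 < pi / 2 - arctan k" "pi / 2 - arctan k < pi"
    using arctan_lbound[of k] arctan_ubound[of k] by auto
  show "cot (pi / 2 - arctan k) = k"
    using tan_arctan[of k] by (simp add: cot_def tan_def cos_diff sin_diff)
qed

section \<open>Constant-speed curves and their tangent circles\<close>

text \<open>The remainder \<open>z\<close> is orthogonal to \<open>x\<close> and \<open>u\<close>,
  so Lagrange's identity gives \<open>cross3 z n = 0\<close>, while \<open>z\<close> is also
  orthogonal to the unit vector \<open>n\<close>; together these force \<open>z = 0\<close>.\<close>

lemma orthonormal_expansion_cross3:
  fixes x u w :: "real^3"
  assumes x: "norm x = 1" and u: "norm u = 1" and xu: "x \<bullet> u = 0"
  shows "w = (w \<bullet> x) *\<^sub>R x + (w \<bullet> u) *\<^sub>R u + (w \<bullet> cross3 x u) *\<^sub>R cross3 x u"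
proof -
  define n where "n = cross3 x u"
  have n: "n \<bullet> n = 1" "x \<bullet> n = 0" "u \<bullet> n = 0" "n \<bullet> x = 0"
    "n \<bullet> u = 0"
    using cross_frame(1)[OF x u xu] by (auto simp: n_def dot_cross_self norm_eq_1)
  have o: "x \<bullet> x = 1" "u \<bullet> u = 1" "u \<bullet> x = 0" using x u xu
    by (auto simp: norm_eq_1 inner_commute)
  define z
    where "z = w - ((w \<bullet> x) *\<^sub>R x + (w \<bullet> u) *\<^sub>R u + (w \<bullet> n) *\<^sub>R n)"
  have z: "z \<bullet> x = 0" "z \<bullet> u = 0" "z \<bullet> n = 0"
    using n o xu by (simp_all add: z_def algebra_simps inner_diff_left inner_add_left)
  have "cross3 z n = 0" using z by (simp add: n_def Lagrange)
  then have "(norm z)\<^sup>2 = 0"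
    using norm_cross_dot[of z n] z(3) n(1) by (auto simp: norm_eq_1[symmetric])
  then show ?thesis by (simp add: z_def n_def)
qed

section \<open>Contact inequalities along a constant-speed curve\<close>

text \<open>\<open>T\<close> is only assumed continuous, so the same setting serves before and after
  \<open>T\<close> is known to be Lipschitz.\<close>

locale const_speed_curve =
  fixes \<gamma> T :: "real \<Rightarrow> real^3" and L :: real
  assumes L: "L > 0"
    and deriv: "t \<in> {0..1} \<Longrightarrow> (\<gamma> has_vector_derivative L *\<^sub>R T t) (at t within {0..1})"
    and norm_\<gamma>: "t \<in> {0..1} \<Longrightarrow> norm (\<gamma> t) = 1"
    and norm_T: "t \<in> {0..1} \<Longrightarrow> norm (T t) = 1"
    and \<gamma>_T: "t \<in> {0..1} \<Longrightarrow> \<gamma> t \<bullet> T t = 0"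
    and cont_T: "continuous_on {0..1} T"
begin

definition n :: "real \<Rightarrow> real^3" where "n t = cross3 (\<gamma> t) (T t)"

text \<open>For \<open>\<sigma> = 1\<close> this says that the circle of curvature \<open>k\<close> is tangent from the left at
  \<open>t\<close>, for \<open>\<sigma> = -1\<close> that the circle of curvature \<open>-k\<close> is tangent from the right.\<close>

definition contact :: "real \<Rightarrow> real \<Rightarrow> real \<Rightarrow> bool" where
  "contact \<sigma> k t \<longleftrightarrow> (\<forall>\<^sub>F s in at t within {0..1}. \<sigma> * (\<gamma> s \<bullet> n t) \<le> k * (1 - \<gamma> s \<bullet> \<gamma> t))"

lemma frame:
  assumes "t \<in> {0..1}"
  shows "\<gamma> t \<bullet> \<gamma> t = 1" "T t \<bullet> T t = 1" "n t \<bullet> n t = 1"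
    "\<gamma> t \<bullet> T t = 0" "T t \<bullet> \<gamma> t = 0" "\<gamma> t \<bullet> n t = 0"
      "n t \<bullet> \<gamma> t = 0" "T t \<bullet> n t = 0" "n t \<bullet> T t = 0"
  using norm_\<gamma>[OF assms] norm_T[OF assms] \<gamma>_T[OF assms]
    cross_frame(1)[OF norm_\<gamma>[OF assms] norm_T[OF assms] \<gamma>_T[OF assms]]
  by (auto simp: norm_eq_1 n_def dot_cross_self inner_commute)

lemma expansion:
  assumes "t \<in> {0..1}"
  shows "w = (w \<bullet> \<gamma> t) *\<^sub>R \<gamma> t + (w \<bullet> T t) *\<^sub>R T t + (w \<bullet> n t) *\<^sub>R n t"
  unfolding n_def using assms by (intro orthonormal_expansion_cross3 norm_\<gamma> norm_T \<gamma>_T)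

lemma cont_\<gamma>: "continuous_on {0..1} \<gamma>"
  using deriv has_vector_derivative_continuous continuous_on_eq_continuous_within by blast

lemma cont_n: "continuous_on {0..1} n"
  unfolding n_def[abs_def] by (intro continuous_on_cross cont_\<gamma> cont_T)

lemma deriv_inner:
  assumes "t \<in> {0..1}"
  shows "((\<lambda>s. \<gamma> s \<bullet> w) has_real_derivative L * (T t \<bullet> w)) (at t within {0..1})"
  using bounded_linear.has_vector_derivative[OF bounded_linear_inner_left deriv[OF assms]]
  by (simp add: has_real_derivative_iff_has_vector_derivative)

lemma deriv_inner_interior:
  assumes "0 < t" "t < 1"
  shows "((\<lambda>s. \<gamma> s \<bullet> w) has_real_derivative L * (T t \<bullet> w)) (at t)"
  using deriv_inner[of t w] assms by (simp add: at_within_Icc_at)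

lemma lipschitz_\<gamma>:
  assumes "s \<in> {0..1}" "t \<in> {0..1}"
  shows "norm (\<gamma> s - \<gamma> t) \<le> L * \<bar>s - t\<bar>"
proof -
  have "norm (\<gamma> s - \<gamma> t) \<le> L * norm (s - t)"
  proof (rule differentiable_bound[of "{0..1}"])
    fix x :: real assume x: "x \<in> {0..1}"
    then show "(\<gamma> has_derivative (\<lambda>h. h *\<^sub>R (L *\<^sub>R T x))) (at x within {0..1})"
      using deriv[OF x] by (simp add: has_vector_derivative_def)
    show "onorm (\<lambda>h. h *\<^sub>R (L *\<^sub>R T x)) \<le> L"
      using L norm_T[OF x] by (intro onorm_le) (simp add: abs_mult)
  qed (use assms in auto)
  then show ?thesis by simp
qed

text \<open>The inner product of \<open>\<gamma>\<close> with \<open>T t\<close> has derivative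
  \<open>L > 0\<close> at \<open>t\<close>, so \<open>\<gamma> s\<close> differs from
  \<open>\<gamma> t\<close> for nearby \<open>s \<noteq> t\<close>. Hence
  \<open>1 - \<gamma> s \<bullet> \<gamma> t\<close>, half the squared chord length, is strictly
  positive, which lets contact inequalities with different constants be compared.\<close>

lemma eventually_inner_less_1:
  assumes t: "t \<in> {0..1}"
  shows "\<forall>\<^sub>F s in at t within {0..1}. \<gamma> s \<bullet> \<gamma> t < 1"
proof -
  have "((\<lambda>s. (\<gamma> s \<bullet> T t - \<gamma> t \<bullet> T t) / (s - t)) \<longlongrightarrow> L) (at t within {0..1})"
    using deriv_inner[OF t, of "T t"] frame[OF t] by (simp add: has_field_derivative_iff)
  then have "\<forall>\<^sub>F s in at t within {0..1}. (\<gamma> s \<bullet> T t - \<gamma> t \<bullet> T t) / (s - t) \<noteq> 0"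
    using L by (intro tendsto_imp_eventually_ne) auto
  moreover have "\<forall>\<^sub>F s in at t within {0..1}. s \<in> {0..1}"
    unfolding eventually_at_filter by simp
  ultimately show ?thesis
  proof eventually_elim
    case (elim s)
    then have "\<gamma> s \<noteq> \<gamma> t" by auto
    then have "0 < (norm (\<gamma> s - \<gamma> t))\<^sup>2" by simp
    also have "\<dots> = 2 * (1 - \<gamma> s \<bullet> \<gamma> t)"
      using frame(1)[OF t] frame(1)[OF elim(2)]
      by (simp add: power2_norm_eq_inner inner_diff_left inner_diff_right inner_commute)
    finally show ?case by simp
  qed
qed

lemma contact_mono:
  assumes t: "t \<in> {0..1}" and c: "contact \<sigma> k t" and le: "k \<le> k'"
  shows "contact \<sigma> k' t"
  using c eventually_inner_less_1[OF t] unfolding contact_def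
proof eventually_elim
  case (elim s)
  have "k * (1 - \<gamma> s \<bullet> \<gamma> t) \<le> k' * (1 - \<gamma> s \<bullet> \<gamma> t)"
    using le elim(2) by (intro mult_right_mono) auto
  then show ?case using elim(1) by linarith
qed

text \<open>Adding the two contact inequalities cancels the normal terms and leaves
  \<open>k + k'\<close> times a positive factor.\<close>

lemma contact_le:
  assumes t: "t \<in> {0..1}" and c: "contact 1 k t" "contact (-1) k' t"
  shows "- k' \<le> k"
proof -
  have "\<forall>\<^sub>F s in at t within {0..1}. - k' \<le> k"
    using c eventually_inner_less_1[OF t] unfolding contact_def
  proof eventually_elim
    case (elim s)
    have "0 \<le> (k + k') * (1 - \<gamma> s \<bullet> \<gamma> t)" using elim(1,2)
      by (simp add: algebra_simps)
    then show ?case using elim(3) by (simp add: zero_le_mult_iff)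
  qed
  then show ?thesis using t by (simp add: trivial_limit_within)
qed

text \<open>If \<open>\<sigma> * \<kappa> > k\<close>, then for
  \<open>w = \<sigma> n t + k \<gamma> t\<close> the function \<open>T s \<bullet> w\<close>
  vanishes at \<open>t\<close> with positive derivative, so \<open>\<gamma> s \<bullet> w\<close>
  strictly increases to the right of \<open>t\<close>. Contact says that it stays at or below its
  value at \<open>t\<close>.\<close>

lemma contact_imp_curvature_le:
  assumes t: "0 < t" "t < 1"
    and T': "(T has_vector_derivative L *\<^sub>R (- \<gamma> t + \<kappa> *\<^sub>R n t)) (at t)"
    and c: "contact \<sigma> k t"
  shows "\<sigma> * \<kappa> \<le> k"
proof (rule ccontr)
  assume *: "\<not> \<sigma> * \<kappa> \<le> k"
  have t01: "t \<in> {0..1}" using t by simp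
  note fr = frame[OF t01]
  define w where "w = \<sigma> *\<^sub>R n t + k *\<^sub>R \<gamma> t"
  have "((\<lambda>s. T s \<bullet> w) has_real_derivative (L *\<^sub>R (- \<gamma> t + \<kappa> *\<^sub>R n t)) \<bullet> w) (at t)"
    using bounded_linear.has_vector_derivative[OF bounded_linear_inner_left T']
    by (simp add: has_real_derivative_iff_has_vector_derivative)
  moreover have "(L *\<^sub>R (- \<gamma> t + \<kappa> *\<^sub>R n t)) \<bullet> w = L * (\<sigma> * \<kappa> - k)"
    using fr by (simp add: w_def inner_add_left inner_add_right algebra_simps)
  ultimately have "((\<lambda>s. T s \<bullet> w) has_real_derivative L * (\<sigma> * \<kappa> - k)) (at t)"
    by (simp only:)
  from has_real_derivative_pos_inc_right[OF this] L *
  obtain d where d: "d > 0"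
    "\<And>h. 0 < h \<Longrightarrow> h < d \<Longrightarrow> T t \<bullet> w < T (t + h) \<bullet> w"
      by auto
  have Tw: "T t \<bullet> w = 0" using fr by (simp add: w_def inner_add_right)
  obtain e where e: "e > 0"
    "\<And>s. s \<in> {0..1} \<Longrightarrow> s \<noteq> t \<Longrightarrow> dist s t < e \<Longrightarrow> \<sigma> * (\<gamma> s \<bullet> n t) \<le> k * (1 - \<gamma> s \<bullet> \<gamma> t)"
    using c unfolding contact_def eventually_at by blast
  define q where "q = min (min d e) (1 - t)"
  have q: "q > 0" "q \<le> d" "q \<le> e" "q \<le> 1 - t" unfolding q_def using d(1) e(1) t by linarith+
  define s where "s = t + q / 2"
  have s: "t < s" "s < t + d" "dist s t < e" "s < 1" using q by (auto simp: s_def dist_real_def)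
  have "\<gamma> t \<bullet> w < \<gamma> s \<bullet> w"
  proof (rule DERIV_pos_imp_increasing_open[OF s(1)])
    fix x assume x: "t < x" "x < s"
    have "T x \<bullet> w > 0" using d(2)[of "x - t"] x s Tw by simp
    then show "\<exists>y. ((\<lambda>x. \<gamma> x \<bullet> w) has_real_derivative y) (at x) \<and> y > 0"
      using deriv_inner_interior[of x w] x s t L by (intro exI[of _ "L * (T x \<bullet> w)"]) simp
  next
    show "continuous_on {t..s} (\<lambda>x. \<gamma> x \<bullet> w)"
      by (intro continuous_intros continuous_on_subset[OF cont_\<gamma>]) (use t s in auto)
  qed
  moreover have "\<sigma> * (\<gamma> s \<bullet> n t) \<le> k * (1 - \<gamma> s \<bullet> \<gamma> t)"
    using s t by (intro e(2)) auto
  ultimately show False using fr by (simp add: w_def inner_add_right algebra_simps)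
qed

section \<open>The minimum principle and the Lipschitz bound for the tangent\<close>

text \<open>Having no component along \<open>T t\<close>, \<open>e\<close> combines
  \<open>\<gamma> t\<close> and \<open>\<sigma> n t\<close> with coefficients
  \<open>\<alpha>\<close> and \<open>c\<close>, where \<open>0 \<le> c\<close> and
  \<open>k c < \<alpha>\<close>. Contact weighted by \<open>c\<close> shows that
  \<open>\<gamma> s \<bullet> e\<close> falls short of its value at \<open>t\<close> by at least
  \<open>(\<alpha> - k c) (1 - \<gamma> s \<bullet> \<gamma> t) > 0\<close>.\<close>

lemma eventually_less_at_critical_point:
  assumes t: "t \<in> {0..1}" and c: "contact \<sigma> k t" and \<sigma>: "\<sigma> * \<sigma> = 1"
    and e: "e \<bullet> T t = 0" "0 \<le> e \<bullet> (\<sigma> *\<^sub>R n t)"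
      "k * (e \<bullet> (\<sigma> *\<^sub>R n t)) < e \<bullet> \<gamma> t"
  shows "\<forall>\<^sub>F s in at t within {0..1}. \<gamma> s \<bullet> e < \<gamma> t \<bullet> e"
  using c eventually_inner_less_1[OF t] unfolding contact_def
proof eventually_elim
  case (elim s)
  define \<alpha> where "\<alpha> = e \<bullet> \<gamma> t"
  define c where "c = \<sigma> * (e \<bullet> n t)"
  have c: "0 \<le> c" "k * c < \<alpha>" using e by (simp_all add: c_def \<alpha>_def)
  have "e = \<alpha> *\<^sub>R \<gamma> t + (\<sigma> * c) *\<^sub>R n t"
    using expansion[OF t, of e] e(1) \<sigma> by (simp add: c_def \<alpha>_def mult.assoc[symmetric])
  then have "\<gamma> s \<bullet> e = \<gamma> s \<bullet> (\<alpha> *\<^sub>R \<gamma> t + (\<sigma> * c) *\<^sub>R n t)"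
    by (rule arg_cong)
  also have "\<dots> = \<alpha> * (\<gamma> s \<bullet> \<gamma> t) + c * (\<sigma> * (\<gamma> s \<bullet> n t))"
    by (simp add: inner_add_right)
  also have "\<dots> \<le> \<alpha> * (\<gamma> s \<bullet> \<gamma> t) + c * (k * (1 - \<gamma> s \<bullet> \<gamma> t))"
    using mult_left_mono[OF elim(1) c(1)] by simp
  also have "\<dots> < \<alpha>"
    using mult_strict_right_mono[OF c(2), of "1 - \<gamma> s \<bullet> \<gamma> t"] elim(2)
      by (simp add: algebra_simps)
  also have "\<alpha> = \<gamma> t \<bullet> e" by (simp add: \<alpha>_def inner_commute)
  finally show ?case .
qed

text \<open>A minimum over \<open>{a..b}\<close> is excluded at \<open>a\<close> by the negative
  slope and at \<open>b\<close> by the assumed positive slope. An interior one would be a critical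
  point, hence a strict local maximum by \<open>eventually_less_at_critical_point\<close>.\<close>

lemma no_descent_then_ascent:
  assumes ab: "0 \<le> a" "a < b" "b \<le> 1" and \<sigma>: "\<sigma> * \<sigma> = 1"
    and c: "\<And>t. a < t \<Longrightarrow> t < b \<Longrightarrow> contact \<sigma> k t"
    and e: "\<And>t. a < t \<Longrightarrow> t < b \<Longrightarrow> 0 \<le> e \<bullet> (\<sigma> *\<^sub>R n t) \<and> k * (e \<bullet> (\<sigma> *\<^sub>R n t)) < e \<bullet> \<gamma> t"
    and neg: "T a \<bullet> e < 0"
  shows "T b \<bullet> e \<le> 0"
proof (rule ccontr)
  assume pos: "\<not> T b \<bullet> e \<le> 0"
  define \<psi> where "\<psi> = (\<lambda>s. \<gamma> s \<bullet> e)"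
  have sub: "{a..b} \<subseteq> {0..1}" using ab by auto
  have D: "(\<psi> has_real_derivative L * (T t \<bullet> e)) (at t within {a..b})" if "t \<in> {a..b}"
    for t
    using deriv_inner[of t e] that sub DERIV_subset unfolding \<psi>_def by blast
  have "continuous_on {a..b} \<psi>"
    unfolding \<psi>_def by (intro continuous_intros continuous_on_subset[OF cont_\<gamma> sub])
  then obtain t where t: "t \<in> {a..b}"
    and min: "\<And>s. s \<in> {a..b} \<Longrightarrow> \<psi> t \<le> \<psi> s"
    using continuous_attains_inf[of "{a..b}" \<psi>] ab by auto
  have "t \<noteq> a"
  proof
    assume [simp]: "t = a"
    have "L * (T a \<bullet> e) < 0" using neg L by (simp add: mult_pos_neg)
    from has_real_derivative_neg_dec_right[OF D[OF t, simplified] this]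
    obtain d where d: "d > 0"
      "\<And>h. 0 < h \<Longrightarrow> a + h \<in> {a..b} \<Longrightarrow> h < d \<Longrightarrow> \<psi> (a + h) < \<psi> a"
        by auto
    have "\<psi> (a + min d (b - a) / 2) < \<psi> a" using d(1) ab
      by (intro d(2)) (auto simp: min_def field_simps)
    moreover have "\<psi> a \<le> \<psi> (a + min d (b - a) / 2)"
      using min[of "a + min d (b - a) / 2"] d(1) ab by (auto simp: min_def field_simps)
    ultimately show False by simp
  qed
  moreover have "t \<noteq> b"
  proof
    assume [simp]: "t = b"
    have "L * (T b \<bullet> e) > 0" using pos L by simp
    from has_real_derivative_pos_inc_left[OF D[OF t, simplified] this]
    obtain d where d: "d > 0"
      "\<And>h. 0 < h \<Longrightarrow> b - h \<in> {a..b} \<Longrightarrow> h < d \<Longrightarrow> \<psi> (b - h) < \<psi> b"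
        by auto
    have "\<psi> (b - min d (b - a) / 2) < \<psi> b" using d(1) ab
      by (intro d(2)) (auto simp: min_def field_simps)
    moreover have "\<psi> b \<le> \<psi> (b - min d (b - a) / 2)"
      using min[of "b - min d (b - a) / 2"] d(1) ab by (auto simp: min_def field_simps)
    ultimately show False by simp
  qed
  ultimately have t': "a < t" "t < b" using t by auto
  have t01: "0 < t" "t < 1" using t' ab by auto
  have "L * (T t \<bullet> e) = 0"
  proof (rule DERIV_local_min)
    show "(\<psi> has_real_derivative L * (T t \<bullet> e)) (at t)" unfolding \<psi>_def
      by (rule deriv_inner_interior[OF t01])
    show "0 < min (t - a) (b - t)" using t' by simp
    show "\<forall>y. \<bar>t - y\<bar> < min (t - a) (b - t) \<longrightarrow> \<psi> t \<le> \<psi> y"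
      by (auto intro!: min)
  qed
  then have "e \<bullet> T t = 0" using L by (simp add: inner_commute)
  then have "\<forall>\<^sub>F s in at t within {0..1}. \<gamma> s \<bullet> e < \<gamma> t \<bullet> e"
    using eventually_less_at_critical_point[OF _ c[OF t'] \<sigma>] e[OF t'] t01 by auto
  then have "\<forall>\<^sub>F s in at t. \<gamma> s \<bullet> e < \<gamma> t \<bullet> e" using t01
    by (simp add: at_within_Icc_at)
  moreover have "\<forall>\<^sub>F s in at t. s \<in> {a<..<b}"
    using t' by (intro eventually_at_in_open') auto
  ultimately have "\<forall>\<^sub>F s in at t. False"
  proof eventually_elim
    case (elim s)
    then show ?case using min[of s] by (auto simp: \<psi>_def)
  qed
  then show False by simp
qed

text \<open>The neighbourhood in a contact inequality depends on \<open>t\<close>, but the minimum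
  principle only asks that the test vector be close to \<open>k' \<gamma> t + \<sigma> n t\<close>
  for all \<open>t\<close> between \<open>a\<close> and \<open>b\<close>. Uniform continuity of the
  frame achieves this with a single \<open>\<delta>\<close>.\<close>

lemma tangent_one_sided_bound:
  assumes \<sigma>: "\<sigma> = 1 \<or> \<sigma> = -1"
    and c: "\<And>t. 0 < t \<Longrightarrow> t < 1 \<Longrightarrow> contact \<sigma> k t"
      and kk': "k < k'"
  obtains \<delta> where "\<delta> > 0"
    "\<And>a b. 0 \<le> a \<Longrightarrow> a < b \<Longrightarrow> b \<le> 1 \<Longrightarrow> b - a < \<delta> \<Longrightarrow> T b \<bullet> (k' *\<^sub>R \<gamma> a + \<sigma> *\<^sub>R n a) \<le> 0"
proof -
  \<comment> \<open>The coefficients of \<open>w t\<close> along \<open>\<gamma> t\<close> and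
    \<open>\<sigma> n t\<close> are \<open>k'\<close> and \<open>1\<close>. An error of at most
    \<open>1/2\<close> keeps the second positive, and
    \<open>\<epsilon> (1 + \<bar>k\<bar>) \<le> (k' - k) / 2\<close> keeps \<open>k\<close> times
    the second below the first.\<close>
  define \<epsilon> where "\<epsilon> = min (1/2) ((k' - k) / (2 * (1 + \<bar>k\<bar>)))"
  have \<epsilon>: "\<epsilon> > 0" "\<epsilon> \<le> 1/2" using kk' unfolding \<epsilon>_def
    by (simp add: add_pos_nonneg, intro min.cobounded1)
  have "\<epsilon> \<le> (k' - k) / (2 * (1 + \<bar>k\<bar>))" unfolding \<epsilon>_def
    by (rule min.cobounded2)
  moreover have "2 * (1 + \<bar>k\<bar>) > 0" by simp
  ultimately have "\<epsilon> * (2 * (1 + \<bar>k\<bar>)) \<le> k' - k" by (simp add: pos_le_divide_eq)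
  then have \<epsilon>k: "2 * (\<epsilon> + \<bar>k\<bar> * \<epsilon>) \<le> k' - k"
    by (simp add: algebra_simps)
  define w where "w = (\<lambda>a. k' *\<^sub>R \<gamma> a + \<sigma> *\<^sub>R n a)"
  have "uniformly_continuous_on {0..1} w"
    unfolding w_def by (intro compact_uniformly_continuous continuous_intros cont_\<gamma> cont_n) simp
  then obtain \<delta> where \<delta>: "\<delta> > 0"
    "\<And>s t. s \<in> {0..1} \<Longrightarrow> t \<in> {0..1} \<Longrightarrow> dist t s < \<delta> \<Longrightarrow> dist (w t) (w s) < \<epsilon> / 2"
    using half_gt_zero[OF \<epsilon>(1)] by (rule uniformly_continuous_onE) blast
  have "T b \<bullet> w a \<le> 0" if ab: "0 \<le> a" "a < b" "b \<le> 1" "b - a < \<delta>" for a b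
  proof (rule le_if_le_add_small[of "\<epsilon> / 2" _ _ 1])
    fix \<eta> assume \<eta>: "0 < \<eta>" "\<eta> < \<epsilon> / 2"
    \<comment> \<open>The tilt makes \<open>T a \<bullet> e = - \<eta>\<close> negative, as the
      minimum principle requires, and costs at most \<open>\<eta>\<close> in the bound at
      \<open>b\<close>.\<close>
    define e where "e = w a - \<eta> *\<^sub>R T a"
    have a01: "a \<in> {0..1}" and b01: "b \<in> {0..1}" using ab by auto
    have "T b \<bullet> e \<le> 0"
    proof (rule no_descent_then_ascent[OF ab(1-3) _ c])
      show "\<sigma> * \<sigma> = 1" using \<sigma> by auto
      show "T a \<bullet> e < 0" using \<eta> frame[OF a01]
        by (simp add: e_def w_def inner_diff_right inner_add_right)
    next
      fix t assume t: "a < t" "t < b"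
      have t01: "t \<in> {0..1}" using t ab by auto
      have "norm (e - w t) \<le> norm (w a - w t) + norm (\<eta> *\<^sub>R T a)"
        unfolding e_def using norm_triangle_ineq4[of "w a - w t" "\<eta> *\<^sub>R T a"]
          by (simp add: algebra_simps)
      also have "\<dots> < \<epsilon> / 2 + \<epsilon> / 2"
        using \<delta>(2)[OF t01 a01] t ab \<eta> norm_T[OF a01]
          by (intro add_strict_mono) (auto simp: dist_norm)
      finally have d: "norm (e - w t) \<le> \<epsilon>" by simp
      have in1: "\<bar>(e - w t) \<bullet> z\<bar> \<le> \<epsilon>" if "norm z = 1" for z
        using Cauchy_Schwarz_ineq2[of "e - w t" z] that d by simp
      have n1: "norm (\<sigma> *\<^sub>R n t) = 1" using frame(3)[OF t01] \<sigma>
        by (auto simp: norm_eq_1)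
      have "w t \<bullet> \<gamma> t = k'" "w t \<bullet> (\<sigma> *\<^sub>R n t) = 1"
        using frame[OF t01] \<sigma> by (auto simp: w_def inner_add_left)
      then have b1: "\<bar>e \<bullet> \<gamma> t - k'\<bar> \<le> \<epsilon>"
        and b2: "\<bar>e \<bullet> (\<sigma> *\<^sub>R n t) - 1\<bar> \<le> \<epsilon>"
        using in1[OF norm_\<gamma>[OF t01]] in1[OF n1] by (simp_all only: inner_diff_left)
      define c where "c = e \<bullet> (\<sigma> *\<^sub>R n t)"
      have "k * c - k = k * (c - 1)" by (simp add: right_diff_distrib)
      also have "\<dots> \<le> \<bar>k * (c - 1)\<bar>" by (rule abs_ge_self)
      also have "\<dots> = \<bar>k\<bar> * \<bar>c - 1\<bar>" by (rule abs_mult)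
      also have "\<dots> \<le> \<bar>k\<bar> * \<epsilon>" using b2
        by (intro mult_left_mono) (auto simp: c_def)
      finally have "k * c - k \<le> \<bar>k\<bar> * \<epsilon>" .
      moreover have "0 \<le> \<bar>k\<bar> * \<epsilon>" using \<epsilon>(1) by simp
      moreover have "k' - \<epsilon> \<le> e \<bullet> \<gamma> t" using b1 by linarith
      moreover have "2 * \<epsilon> + 2 * (\<bar>k\<bar> * \<epsilon>) \<le> k' - k" using \<epsilon>k
        by (simp only: distrib_left)
      ultimately have "k * c < e \<bullet> \<gamma> t" using \<epsilon>(1) by argo
      then show "0 \<le> e \<bullet> (\<sigma> *\<^sub>R n t) \<and> k * (e \<bullet> (\<sigma> *\<^sub>R n t)) < e \<bullet> \<gamma> t"
        using b2 \<epsilon>(2) unfolding c_def by linarith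
    qed (use ab in auto)
    then have "T b \<bullet> w a \<le> \<eta> * (T b \<bullet> T a)"
      by (simp add: e_def inner_diff_right)
    also have "\<dots> \<le> \<eta> * 1"
      using norm_cauchy_schwarz[of "T b" "T a"] norm_T[OF a01] norm_T[OF b01] \<eta>
        by (intro mult_left_mono) auto
    finally show "T b \<bullet> w a \<le> 0 + 1 * \<eta>" by simp
  qed (use \<epsilon> in auto)
  then show thesis using that \<delta>(1) unfolding w_def by blast
qed

text \<open>\<open>T b\<close> is expanded in the frame at \<open>a\<close>. Its component along
  \<open>\<gamma> a\<close> is \<open>O(b - a)\<close> because \<open>T b\<close> is orthogonal to
  \<open>\<gamma> b\<close>, and the two contacts bound the component along \<open>n a\<close> from
  both sides. For \<open>b\<close> near \<open>a\<close> the unit vector \<open>T b\<close> is then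
  within \<open>O(b - a)\<close> of \<open>T a\<close>.\<close>

lemma contact_imp_lipschitz:
  assumes c1: "\<And>t. 0 < t \<Longrightarrow> t < 1 \<Longrightarrow> contact 1 k\<^sub>1 t"
    and c2: "\<And>t. 0 < t \<Longrightarrow> t < 1 \<Longrightarrow> contact (-1) k\<^sub>2 t"
  shows "\<exists>K. K-lipschitz_on {0..1} T"
proof -
  obtain \<delta>1 where \<delta>1: "\<delta>1 > 0"
    "\<And>a b. 0 \<le> a \<Longrightarrow> a < b \<Longrightarrow> b \<le> 1 \<Longrightarrow> b - a < \<delta>1 \<Longrightarrow> T b \<bullet> ((k\<^sub>1 + 1) *\<^sub>R \<gamma> a + 1 *\<^sub>R n a) \<le> 0"
    using tangent_one_sided_bound[of 1 k\<^sub>1 "k\<^sub>1 + 1", OF _ c1] by auto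
  obtain \<delta>2 where \<delta>2: "\<delta>2 > 0"
    "\<And>a b. 0 \<le> a \<Longrightarrow> a < b \<Longrightarrow> b \<le> 1 \<Longrightarrow> b - a < \<delta>2 \<Longrightarrow> T b \<bullet> ((k\<^sub>2 + 1) *\<^sub>R \<gamma> a + (-1) *\<^sub>R n a) \<le> 0"
    using tangent_one_sided_bound[of "-1" k\<^sub>2 "k\<^sub>2 + 1", OF _ c2] by auto
  have "uniformly_continuous_on {0..1} T"
    by (intro compact_uniformly_continuous cont_T) simp
  then obtain \<delta>3 where \<delta>3: "\<delta>3 > 0"
    "\<And>s t. s \<in> {0..1} \<Longrightarrow> t \<in> {0..1} \<Longrightarrow> dist t s < \<delta>3 \<Longrightarrow> dist (T t) (T s) < 1"
    using zero_less_one by (rule uniformly_continuous_onE) blast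
  define \<delta> where "\<delta> = min \<delta>1 (min \<delta>2 \<delta>3)"
  have \<delta>: "\<delta> > 0" "\<delta> \<le> \<delta>1" "\<delta> \<le> \<delta>2" "\<delta> \<le> \<delta>3"
    using \<delta>1 \<delta>2 \<delta>3 by (auto simp: \<delta>_def)
  define C where "C = (1 + \<bar>k\<^sub>1 + 1\<bar> + \<bar>k\<^sub>2 + 1\<bar>) * L"
  have CL: "C \<ge> L" using L by (simp add: C_def algebra_simps)
  have near: "norm (T b - T a) \<le> 2 * C * (b - a)" if ab: "0 \<le> a" "a < b" "b \<le> 1"
    "b - a < \<delta>" for a b
  proof -
    have a01: "a \<in> {0..1}" and b01: "b \<in> {0..1}" using ab by auto
    have "T b \<bullet> \<gamma> a = T b \<bullet> (\<gamma> a - \<gamma> b)" using frame[OF b01]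
      by (simp add: inner_diff_right)
    then have "\<bar>T b \<bullet> \<gamma> a\<bar> \<le> norm (T b) * norm (\<gamma> a - \<gamma> b)"
      using Cauchy_Schwarz_ineq2 by metis
    then have g: "\<bar>T b \<bullet> \<gamma> a\<bar> \<le> L * (b - a)"
      using lipschitz_\<gamma>[OF a01 b01] norm_T[OF b01] ab by simp
    have kg: "\<bar>k * (T b \<bullet> \<gamma> a)\<bar> \<le> \<bar>k\<bar> * (L * (b - a))" for k
      unfolding abs_mult using g by (intro mult_left_mono) auto
    have pos: "0 \<le> L * (b - a)" "0 \<le> \<bar>k\<^sub>1 + 1\<bar> * (L * (b - a))" "0 \<le> \<bar>k\<^sub>2 + 1\<bar> * (L * (b - a))"
      using L ab by auto
    have "T b \<bullet> n a \<le> - ((k\<^sub>1 + 1) * (T b \<bullet> \<gamma> a))"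
      "- (T b \<bullet> n a) \<le> - ((k\<^sub>2 + 1) * (T b \<bullet> \<gamma> a))"
      using \<delta>1(2)[of a b] \<delta>2(2)[of a b] ab \<delta>
        by (auto simp: inner_add_right inner_diff_right)
    moreover have "C * (b - a) = L * (b - a) + \<bar>k\<^sub>1 + 1\<bar> * (L * (b - a)) + \<bar>k\<^sub>2 + 1\<bar> * (L * (b - a))"
      by (simp add: C_def algebra_simps)
    ultimately have n: "\<bar>T b \<bullet> n a\<bar> \<le> C * (b - a)"
      using kg[of "k\<^sub>1 + 1"] kg[of "k\<^sub>2 + 1"] pos by linarith
    have g': "\<bar>T b \<bullet> \<gamma> a\<bar> \<le> C * (b - a)"
      using g mult_right_mono[OF CL, of "b - a"] ab by linarith
    define c where "c = T b \<bullet> T a"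
    have sq: "(norm (T b - T a))\<^sup>2 = 2 - 2 * c"
      using frame[OF a01] frame[OF b01]
      by (simp add: c_def power2_norm_eq_inner inner_diff_left inner_diff_right inner_commute)
    \<comment> \<open>Distance below \<open>1\<close> makes \<open>c\<close> positive, so
      \<open>c\<^sup>2 \<le> c\<close>. Then \<open>2 - 2 * c\<close> is at most
      \<open>2 * (1 - c\<^sup>2)\<close>, which is twice the sum of the other two squared
      components.\<close>
    have "norm (T b - T a) < 1" using \<delta>3(2)[OF a01 b01] ab \<delta> by (simp add: dist_norm)
    then have "(norm (T b - T a))\<^sup>2 < 1" by (simp add: power_less_one_iff abs_square_less_1)
    then have c0: "c > 0" using sq by simp
    have c1: "c \<le> 1" using sq zero_le_power2[of "norm (T b - T a)"] by linarith
    have "T b \<bullet> T b = T b \<bullet> ((T b \<bullet> \<gamma> a) *\<^sub>R \<gamma> a + (T b \<bullet> T a) *\<^sub>R T a + (T b \<bullet> n a) *\<^sub>R n a)"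
      using expansion[OF a01, of "T b"] by simp
    then have "1 = (T b \<bullet> \<gamma> a)\<^sup>2 + c\<^sup>2 + (T b \<bullet> n a)\<^sup>2"
      using frame[OF b01] by (simp add: inner_add_right c_def power2_eq_square)
    moreover have "(T b \<bullet> \<gamma> a)\<^sup>2 \<le> (C * (b - a))\<^sup>2"
      "(T b \<bullet> n a)\<^sup>2 \<le> (C * (b - a))\<^sup>2"
      using power_mono[OF g', of 2] power_mono[OF n, of 2] by simp_all
    moreover have "c\<^sup>2 \<le> c" using c0 c1 by (simp add: power2_eq_square mult_left_le)
    ultimately have "(norm (T b - T a))\<^sup>2 \<le> 4 * (C * (b - a))\<^sup>2" using sq by linarith
    then have "(norm (T b - T a))\<^sup>2 \<le> (2 * C * (b - a))\<^sup>2"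
      by (simp add: power_mult_distrib)
    then show ?thesis by (rule power2_le_imp_le) (use CL L ab in auto)
  qed
  \<comment> \<open>Close pairs need \<open>2 * C\<close>; pairs at distance at least
    \<open>\<delta>\<close> are covered by \<open>2 / \<delta>\<close>, since unit vectors differ by
    at most \<open>2\<close>.\<close>
  define K where "K = 2 * C + 2 / \<delta>"
  have C0: "C \<ge> 0" using CL L by simp
  have K: "norm (T b - T a) \<le> K * (b - a)" if ab: "0 \<le> a" "a < b" "b \<le> 1" for a b
  proof (cases "b - a < \<delta>")
    case True
    have "0 \<le> 2 / \<delta> * (b - a)" using \<delta> ab by simp
    then show ?thesis using near[OF ab True] by (simp add: K_def distrib_right)
  next
    case False
    have "norm (T b - T a) \<le> norm (T b) + norm (T a)" by (rule norm_triangle_ineq4)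
    also have "\<dots> = 2" using norm_T ab by simp
    also have "\<dots> \<le> 2 / \<delta> * (b - a)" using False \<delta> by (simp add: field_simps)
    also have "\<dots> \<le> K * (b - a)" using C0 ab by (simp add: K_def distrib_right)
    finally show ?thesis .
  qed
  have "K-lipschitz_on {0..1} T"
  proof (rule lipschitz_onI)
    show "0 \<le> K" using C0 \<delta> by (simp add: K_def)
    fix x y :: real assume "x \<in> {0..1}" "y \<in> {0..1}"
    then show "dist (T x) (T y) \<le> K * dist x y"
      using K[of x y] K[of y x]
        by (cases x y rule: linorder_cases) (auto simp: dist_norm norm_minus_commute)
  qed
  then show ?thesis by blast
qed

section \<open>Contact from almost everywhere curvature bounds\<close>

text \<open>For \<open>w = \<sigma> n t + k' \<gamma> t\<close> the derivative of
  \<open>T s \<bullet> w\<close> near \<open>t\<close> differs from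
  \<open>L (\<sigma> \<kappa> - k')\<close> by a small multiple of
  \<open>1 + \<bar>\<kappa>\<bar>\<close>. The bound \<open>B\<close> makes this error uniform and
  the gap \<open>k' - k\<close> absorbs it, so \<open>T s \<bullet> w\<close> decreases near
  \<open>t\<close>.\<close>

lemma curvature_le_imp_contact:
  assumes K: "K-lipschitz_on {0..1} T" and N: "negligible N"
    and T': "\<And>s. s \<in> {0<..<1} - N \<Longrightarrow> \<exists>\<kappa>. (T has_vector_derivative L *\<^sub>R (- \<gamma> s + \<kappa> *\<^sub>R n s)) (at s)
      \<and> \<sigma> * \<kappa> \<le> k \<and> \<bar>\<kappa>\<bar> \<le> B"
    and kk': "k < k'" and t: "t \<in> {0..1}"
  shows "contact \<sigma> k' t"
proof -
  note fr = frame[OF t]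
  define w where "w = \<sigma> *\<^sub>R n t + k' *\<^sub>R \<gamma> t"
  \<comment> \<open>This spends the gap exactly: an error \<open>\<epsilon>\<close> in
    \<open>\<gamma> s \<bullet> w\<close> and an error \<open>\<epsilon>\<close> in
    \<open>n s \<bullet> w\<close>, multiplied by at most \<open>\<bar>B\<bar>\<close>, add up to
    \<open>k' - k\<close>.\<close>
  define \<epsilon> where "\<epsilon> = (k' - k) / (1 + \<bar>B\<bar>)"
  have B: "1 + \<bar>B\<bar> > 0" by simp
  have "\<epsilon> * (1 + \<bar>B\<bar>) = k' - k" unfolding \<epsilon>_def using B by simp
  then have \<epsilon>: "\<epsilon> > 0" "\<epsilon> + \<bar>B\<bar> * \<epsilon> = k' - k"
    using kk' B by (simp add: \<epsilon>_def, simp add: algebra_simps)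
  have "\<forall>\<^sub>F s in at t within {0..1}. dist (\<gamma> s \<bullet> w) (\<gamma> t \<bullet> w) < \<epsilon>"
    using cont_\<gamma> t \<epsilon>(1) by (intro tendstoD tendsto_intros) (auto simp: continuous_on_def)
  moreover have "\<forall>\<^sub>F s in at t within {0..1}. dist (n s \<bullet> w) (n t \<bullet> w) < \<epsilon>"
    using cont_n t \<epsilon>(1) by (intro tendstoD tendsto_intros) (auto simp: continuous_on_def)
  ultimately obtain \<delta> where \<delta>: "\<delta> > 0"
    "\<And>s. s \<in> {0..1} \<Longrightarrow> s \<noteq> t \<Longrightarrow> dist s t < \<delta> \<Longrightarrow> dist (\<gamma> s \<bullet> w) (\<gamma> t \<bullet> w) < \<epsilon> \<and> dist (n s \<bullet> w) (n t \<bullet> w) < \<epsilon>"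
    using eventually_conj unfolding eventually_at by (smt (verit, ccfv_threshold))
  have tw: "\<gamma> t \<bullet> w = k'" "n t \<bullet> w = \<sigma>" "T t \<bullet> w = 0"
    using fr by (simp_all add: w_def inner_add_right)
  have close: "\<bar>\<gamma> s \<bullet> w - k'\<bar> \<le> \<epsilon> \<and> \<bar>n s \<bullet> w - \<sigma>\<bar> \<le> \<epsilon>"
    if "s \<in> {0..1}" "dist s t < \<delta>" for s
    using \<delta>(2)[OF that(1) _ that(2)] tw \<epsilon> by (cases "s = t") (auto simp: dist_real_def)
  have decr: "T b \<bullet> w \<le> T a \<bullet> w" if ab: "0 \<le> a" "a \<le> b" "b \<le> 1"
    "dist a t < \<delta>" "dist b t < \<delta>" for a b
  proof (rule lipschitz_AE_deriv_nonpos_imp_le[OF _ ab(2) N])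
    show "(K * norm w)-lipschitz_on {a..b} (\<lambda>s. T s \<bullet> w)"
    proof (rule lipschitz_onI)
      show "0 \<le> K * norm w" using lipschitz_on_nonneg[OF K] by simp
      fix x y assume xy: "x \<in> {a..b}" "y \<in> {a..b}"
      have "\<bar>T x \<bullet> w - T y \<bullet> w\<bar> \<le> norm (T x - T y) * norm w"
        unfolding inner_diff_left[symmetric] by (rule Cauchy_Schwarz_ineq2)
      also have "\<dots> \<le> K * dist x y * norm w"
        using lipschitz_onD[OF K, of x y] xy ab by (intro mult_right_mono) (auto simp: dist_norm)
      finally show "dist (T x \<bullet> w) (T y \<bullet> w) \<le> K * norm w * dist x y"
        by (simp add: dist_real_def mult_ac)
    qed
    fix x assume x: "x \<in> {a<..<b} - N"
    then obtain \<kappa>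
      where \<kappa>: "(T has_vector_derivative L *\<^sub>R (- \<gamma> x + \<kappa> *\<^sub>R n x)) (at x)"
        "\<sigma> * \<kappa> \<le> k" "\<bar>\<kappa>\<bar> \<le> B"
      using T'[of x] ab by auto
    have "((\<lambda>s. T s \<bullet> w) has_real_derivative (L *\<^sub>R (- \<gamma> x + \<kappa> *\<^sub>R n x)) \<bullet> w) (at x)"
      using bounded_linear.has_vector_derivative[OF bounded_linear_inner_left \<kappa>(1)]
      by (simp add: has_real_derivative_iff_has_vector_derivative)
    moreover have "(L *\<^sub>R (- \<gamma> x + \<kappa> *\<^sub>R n x)) \<bullet> w \<le> 0"
    proof -
      have "dist x t < \<delta>" using x ab by (auto simp: dist_real_def)
      then have cl: "\<bar>\<gamma> x \<bullet> w - k'\<bar> \<le> \<epsilon>" "\<bar>n x \<bullet> w - \<sigma>\<bar> \<le> \<epsilon>"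
        using close[of x] x ab by auto
      have "\<kappa> * (n x \<bullet> w - \<sigma>) \<le> \<bar>\<kappa>\<bar> * \<bar>n x \<bullet> w - \<sigma>\<bar>"
        by (metis abs_ge_self abs_mult)
      also have "\<dots> \<le> \<bar>B\<bar> * \<epsilon>" using \<kappa>(3) cl by (intro mult_mono) auto
      finally have "\<kappa> * (n x \<bullet> w) - \<sigma> * \<kappa> \<le> \<bar>B\<bar> * \<epsilon>"
        by (simp add: algebra_simps)
      then have "- (\<gamma> x \<bullet> w) + \<kappa> * (n x \<bullet> w) \<le> 0"
        using cl(1) \<kappa>(2) \<epsilon>(2) by linarith
      then show ?thesis using L by (simp add: inner_diff_left mult_le_0_iff)
    qed
    ultimately show "\<exists>D\<le>0. ((\<lambda>s. T s \<bullet> w) has_real_derivative D) (at x)"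
      by blast
  qed
  \<comment> \<open>Since \<open>T t \<bullet> w = 0\<close>, the decreasing function
    \<open>T s \<bullet> w\<close> is nonnegative before \<open>t\<close> and nonpositive after it.
    At an endpoint of \<open>{0..1}\<close> only one side occurs.\<close>
  have "\<gamma> s \<bullet> w \<le> \<gamma> t \<bullet> w" if s: "s \<in> {0..1}" "dist s t < \<delta>"
    for s
  proof (cases "t \<le> s")
    case True
    show ?thesis
    proof (rule DERIV_nonpos_imp_decreasing_open[OF True])
      fix x assume x: "t < x" "x < s"
      have "T x \<bullet> w \<le> 0" using decr[of t x] x s t tw \<delta>(1)
        by (auto simp: dist_real_def)
      then show "\<exists>y. ((\<lambda>x. \<gamma> x \<bullet> w) has_real_derivative y) (at x) \<and> y \<le> 0"
        using deriv_inner_interior[of x w] x s t L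
          by (intro exI[of _ "L * (T x \<bullet> w)"]) (simp add: mult_le_0_iff)
    qed (intro continuous_intros continuous_on_subset[OF cont_\<gamma>], use s t in auto)
  next
    case False
    then have st: "s \<le> t" by simp
    show ?thesis
    proof (rule DERIV_nonneg_imp_increasing_open[OF st])
      fix x assume x: "s < x" "x < t"
      have "T x \<bullet> w \<ge> 0" using decr[of x t] x s t tw \<delta>(1)
        by (auto simp: dist_real_def)
      then show "\<exists>y. ((\<lambda>x. \<gamma> x \<bullet> w) has_real_derivative y) (at x) \<and> y \<ge> 0"
        using deriv_inner_interior[of x w] x s t L by (intro exI[of _ "L * (T x \<bullet> w)"]) simp
    qed (intro continuous_intros continuous_on_subset[OF cont_\<gamma>], use s t in auto)
  qed
  then show ?thesis
    unfolding contact_def eventually_at tw(1)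
    by (intro exI[of _ \<delta>]) (use \<delta>(1) in \<open>auto simp: w_def inner_add_right algebra_simps\<close>)
qed

text \<open>Differentiating \<open>T \<bullet> T = 1\<close> and
  \<open>\<gamma> \<bullet> T = 0\<close> fixes the components of \<open>D\<close> along
  \<open>T t\<close> and \<open>\<gamma> t\<close> as \<open>0\<close> and \<open>- L\<close>; only
  the normal component remains free.\<close>

lemma deriv_T_frame:
  assumes t: "0 < t" "t < 1" and T': "(T has_vector_derivative D) (at t)"
  shows "D = L *\<^sub>R (- \<gamma> t + ((D \<bullet> n t) / L) *\<^sub>R n t)"
proof -
  have t01: "t \<in> {0..1}" using t by simp
  have nb: "\<forall>\<^sub>F s in nhds t. s \<in> {0<..<1}" using t
    by (intro eventually_nhds_in_open) auto
  have \<gamma>': "(\<gamma> has_vector_derivative L *\<^sub>R T t) (at t)" using deriv[OF t01] t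
    by (simp add: at_within_Icc_at)
  have const: "f' = 0" if "(f has_vector_derivative f') (at t)"
    "\<And>s. s \<in> {0<..<1} \<Longrightarrow> f s = c"
    for f :: "real \<Rightarrow> real" and f' c
  proof -
    have "((\<lambda>_. c) has_vector_derivative f') (at t)"
      using has_vector_derivative_transform_within_open[OF that(1), of "{0<..<1}"] that(2) t by auto
    then show ?thesis using vector_derivative_unique_at[OF _ has_vector_derivative_const] by blast
  qed
  have "T t \<bullet> D + D \<bullet> T t = 0"
    by (rule const[OF bounded_bilinear.has_vector_derivative[OF bounded_bilinear_inner T' T'], of 1]) (use frame in auto)
  then have D1: "D \<bullet> T t = 0" by (simp add: inner_commute)
  have "\<gamma> t \<bullet> D + (L *\<^sub>R T t) \<bullet> T t = 0"
    by (rule const[OF bounded_bilinear.has_vector_derivative[OF bounded_bilinear_inner \<gamma>' T'], of 0]) (use frame in auto)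
  then have D2: "D \<bullet> \<gamma> t = - L" using frame[OF t01] by (simp add: inner_commute)
  have "L *\<^sub>R (- \<gamma> t + ((D \<bullet> n t) / L) *\<^sub>R n t) = (D \<bullet> n t) *\<^sub>R n t - L *\<^sub>R \<gamma> t"
    using L by (simp add: scaleR_diff_right)
  then show ?thesis using expansion[OF t01, of D] D1 D2 by simp
qed

end

section \<open>Tangent circles and curvatures of regular curves\<close>

locale const_speed_regular_curve =
  fixes \<gamma> :: "real \<Rightarrow> real^3" and L :: real
  assumes regular: "(0, 1, \<gamma>) \<in> regular_pcurves"
    and speed: "\<And>t. t \<in> {0..1} \<Longrightarrow> norm (velocity {0..1} \<gamma> t) = L"
begin

abbreviation T :: "real \<Rightarrow> real^3" where "T \<equiv> unit_tangent {0..1} \<gamma>"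

abbreviation \<kappa> :: "real \<Rightarrow> real"
  where "\<kappa> \<equiv> geodesic_curvature {0..1} \<gamma>"

lemma C1: "C1_on {0..1} \<gamma>" and L_pos: "L > 0"
  using regular speed[of 0] by (auto simp: regular_pcurves_def)

lemma velocity_eq: "t \<in> {0..1} \<Longrightarrow> velocity {0..1} \<gamma> t = L *\<^sub>R T t"
  and unit_tangent_eq: "t \<in> {0..1} \<Longrightarrow> T t = (1 / L) *\<^sub>R velocity {0..1} \<gamma> t"
  using speed[of t] L_pos by (auto simp: unit_tangent_def divide_inverse)

sublocale const_speed_curve \<gamma> T L
proof
  show "0 < L" by (rule L_pos)
  fix t :: real assume t: "t \<in> {0..1}"
  show "(\<gamma> has_vector_derivative L *\<^sub>R T t) (at t within {0..1})"
    using C1_onD[OF C1 t] velocity_eq[OF t] by simp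
  show "norm (\<gamma> t) = 1" "norm (T t) = 1" "\<gamma> t \<bullet> T t = 0"
    using regular_pcurve_orthonormal[OF regular t] by auto
next
  have "continuous_on {0..1} (\<lambda>t. (1 / L) *\<^sub>R velocity {0..1} \<gamma> t)"
    using C1 by (intro continuous_intros) (simp add: C1_on_def)
  then show "continuous_on {0..1} T" by (rule continuous_on_eq) (rule unit_tangent_eq[symmetric])
qed

lemma n_eq: "n = unit_normal {0..1} \<gamma>"
  by (simp add: fun_eq_iff n_def unit_normal_def)

lemma lipschitz_velocity_iff:
  "(\<exists>K. K-lipschitz_on {0..1} (velocity {0..1} \<gamma>)) \<longleftrightarrow> (\<exists>K. K-lipschitz_on {0..1} T)"
proof
  assume "\<exists>K. K-lipschitz_on {0..1} (velocity {0..1} \<gamma>)"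
  then obtain K where "K-lipschitz_on {0..1} (velocity {0..1} \<gamma>)" ..
  from lipschitz_on_transform[OF lipschitz_on_cmult[OF this, of "1 / L"] unit_tangent_eq]
  show "\<exists>K. K-lipschitz_on {0..1} T" by blast
next
  assume "\<exists>K. K-lipschitz_on {0..1} T"
  then obtain K where "K-lipschitz_on {0..1} T" ..
  from lipschitz_on_transform[OF lipschitz_on_cmult[OF this, of L] velocity_eq]
  show "\<exists>K. K-lipschitz_on {0..1} (velocity {0..1} \<gamma>)" by blast
qed

text \<open>As \<open>arccos\<close> is decreasing, comparing the distance with \<open>r\<close>
  means comparing \<open>\<gamma> s \<bullet> a\<close> with \<open>cos r\<close>. Their difference
  is \<open>sin r > 0\<close> times the difference of the two sides of the contact
  inequality.\<close>

lemma circle_side: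
  assumes t: "t \<in> {0..1}" and s: "s \<in> {0..1}" and r: "0 < r" "r < pi"
  defines "a \<equiv> cos r *\<^sub>R \<gamma> t + sin r *\<^sub>R n t"
  shows "r \<le> sphere_dist (\<gamma> s) a \<longleftrightarrow> \<gamma> s \<bullet> n t \<le> cot r * (1 - \<gamma> s \<bullet> \<gamma> t)"
    and "sphere_dist (\<gamma> s) a \<le> r \<longleftrightarrow> cot r * (1 - \<gamma> s \<bullet> \<gamma> t) \<le> \<gamma> s \<bullet> n t"
proof -
  have sr: "sin r > 0" using r by (simp add: sin_gt_zero)
  have "a \<bullet> a = (cos r)\<^sup>2 + (sin r)\<^sup>2"
    using frame[OF t] by (simp add: a_def inner_add_left inner_add_right power2_eq_square)
  then have "norm a = 1" by (simp add: norm_eq_1)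
  then have le1: "\<bar>\<gamma> s \<bullet> a\<bar> \<le> 1"
    using Cauchy_Schwarz_ineq2[of "\<gamma> s" a] norm_\<gamma>[OF s] by simp
  have ac: "arccos (cos r) = r" using r by (simp add: arccos_cos)
  have sa: "\<gamma> s \<bullet> a = cos r * (\<gamma> s \<bullet> \<gamma> t) + sin r * (\<gamma> s \<bullet> n t)"
    by (simp add: a_def inner_add_right)
  have cr: "cos r = sin r * cot r" using sr by (simp add: cot_def)
  have d: "cos r - \<gamma> s \<bullet> a = sin r * (cot r * (1 - \<gamma> s \<bullet> \<gamma> t) - \<gamma> s \<bullet> n t)"
    unfolding sa by (subst (1 2) cr) (simp add: algebra_simps)
  have "r \<le> sphere_dist (\<gamma> s) a \<longleftrightarrow> 0 \<le> cos r - \<gamma> s \<bullet> a"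
    using arccos_le_mono[of "cos r" "\<gamma> s \<bullet> a"] le1 ac by (simp add: sphere_dist_def)
  also have "\<dots> \<longleftrightarrow> \<gamma> s \<bullet> n t \<le> cot r * (1 - \<gamma> s \<bullet> \<gamma> t)"
    unfolding d using sr by (simp add: zero_le_mult_iff)
  finally show "r \<le> sphere_dist (\<gamma> s) a \<longleftrightarrow> \<gamma> s \<bullet> n t \<le> cot r * (1 - \<gamma> s \<bullet> \<gamma> t)" .
  have "sphere_dist (\<gamma> s) a \<le> r \<longleftrightarrow> cos r - \<gamma> s \<bullet> a \<le> 0"
    using arccos_le_mono[of "\<gamma> s \<bullet> a" "cos r"] le1 ac by (simp add: sphere_dist_def)
  also have "\<dots> \<longleftrightarrow> cot r * (1 - \<gamma> s \<bullet> \<gamma> t) \<le> \<gamma> s \<bullet> n t"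
    unfolding d using sr by (simp add: mult_le_0_iff)
  finally show "sphere_dist (\<gamma> s) a \<le> r \<longleftrightarrow> cot r * (1 - \<gamma> s \<bullet> \<gamma> t) \<le> \<gamma> s \<bullet> n t" .
qed

lemma tangent_from_left_iff_contact:
  assumes t: "t \<in> {0..1}"
  shows "(\<exists>a. tangent_from_left {0..1} \<gamma> t a r) \<longleftrightarrow> 0 < r \<and> r < pi \<and> contact 1 (cot r) t"
proof (cases "0 < r \<and> r < pi")
  case True
  then have r: "0 < r" "r < pi" by auto
  let ?P = "\<lambda>s. \<gamma> s \<bullet> n t \<le> cot r * (1 - \<gamma> s \<bullet> \<gamma> t)"
  have "?P t" using frame[OF t] by simp
  then have "(\<exists>\<delta>>0. \<forall>s\<in>{t - \<delta><..<t + \<delta>} \<inter> {0..1}. ?P s) \<longleftrightarrow> contact 1 (cot r) t"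
    unfolding contact_def mult_1 by (rule near_iff_eventually_within)
  then show ?thesis
    unfolding tangent_from_left_def circle_touches_iff[OF regular t]
    using r circle_side(1)[OF t _ r] by (auto simp: n_eq)
qed (auto simp: tangent_from_left_def circle_touches_iff[OF regular t])

lemma tangent_from_right_iff_contact:
  assumes t: "t \<in> {0..1}"
  shows "(\<exists>a. tangent_from_right {0..1} \<gamma> t a r) \<longleftrightarrow> 0 < r \<and> r < pi \<and> contact (-1) (- cot r) t"
proof (cases "0 < r \<and> r < pi")
  case True
  then have r: "0 < r" "r < pi" by auto
  let ?P = "\<lambda>s. cot r * (1 - \<gamma> s \<bullet> \<gamma> t) \<le> \<gamma> s \<bullet> n t"
  have "?P t" using frame[OF t] by simp
  then have "(\<exists>\<delta>>0. \<forall>s\<in>{t - \<delta><..<t + \<delta>} \<inter> {0..1}. ?P s) \<longleftrightarrow> (\<forall>\<^sub>F s in at t within {0..1}. ?P s)"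
    by (rule near_iff_eventually_within)
  also have "\<dots> \<longleftrightarrow> contact (-1) (- cot r) t" unfolding contact_def by simp
  finally show ?thesis
    unfolding tangent_from_right_def circle_touches_iff[OF regular t]
    using r circle_side(2)[OF t _ r] by (auto simp: n_eq)
qed (auto simp: tangent_from_right_def circle_touches_iff[OF regular t])

text \<open>\<open>cot\<close> maps the radii between \<open>0\<close> and \<open>pi\<close> onto
  all reals, so the infimum over circles becomes one over all contact constants.\<close>

lemma upper_curvature_eq:
  assumes t: "t \<in> {0..1}"
  shows "upper_curvature {0..1} \<gamma> t = Inf {ereal k | k. contact 1 k t}"
proof -
  have "{ereal (cot r) | r. \<exists>a. tangent_from_left {0..1} \<gamma> t a r} = {ereal k | k. contact 1 k t}"
    unfolding tangent_from_left_iff_contact[OF t] by (auto; metis cot_surj)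
  then show ?thesis unfolding upper_curvature_def by (rule arg_cong)
qed

lemma lower_curvature_eq:
  assumes t: "t \<in> {0..1}"
  shows "lower_curvature {0..1} \<gamma> t = Sup {ereal k | k. contact (-1) (- k) t}"
proof -
  have "{ereal (cot r) | r. \<exists>a. tangent_from_right {0..1} \<gamma> t a r} = {ereal k | k. contact (-1) (- k) t}"
    unfolding tangent_from_right_iff_contact[OF t] by (auto; metis cot_surj)
  then show ?thesis unfolding lower_curvature_def by (rule arg_cong)
qed

text \<open>The infimum need not be attained, but some constant below \<open>k\<close> is in
  contact, and \<open>contact_mono\<close> raises it to \<open>k\<close>.\<close>

lemma upper_curvature_less_imp_contact:
  assumes t: "t \<in> {0..1}" and "upper_curvature {0..1} \<gamma> t < ereal k"
  shows "contact 1 k t"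
  using assms(2) contact_mono[OF t] unfolding upper_curvature_eq[OF t] Inf_less_iff
  by (auto intro: less_imp_le)

lemma less_lower_curvature_imp_contact:
  assumes t: "t \<in> {0..1}" and "ereal k < lower_curvature {0..1} \<gamma> t"
  shows "contact (-1) (- k) t"
  using assms(2) contact_mono[OF t] unfolding lower_curvature_eq[OF t] less_Sup_iff
  by (fastforce intro: less_imp_le)

lemma lower_le_upper_curvature:
  assumes t: "t \<in> {0..1}"
  shows "lower_curvature {0..1} \<gamma> t \<le> upper_curvature {0..1} \<gamma> t"
  unfolding upper_curvature_eq[OF t] lower_curvature_eq[OF t]
  using contact_le[OF t] by (fastforce intro!: Sup_least Inf_greatest)

lemma deriv_unit_tangent:
  assumes t: "0 < t" "t < 1" and "T differentiable at t"
  shows "(T has_vector_derivative L *\<^sub>R (- \<gamma> t + \<kappa> t *\<^sub>R n t)) (at t)"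
proof -
  have t01: "t \<in> {0..1}" using t by simp
  obtain D where D: "(T has_vector_derivative D) (at t)"
    using assms(3) vector_derivative_works by blast
  then have "velocity {0..1} T t = D"
    using t by (intro velocityI) (auto simp: at_within_Icc_at)
  then have "\<kappa> t = (D \<bullet> n t) / L"
    unfolding geodesic_curvature_def using speed[OF t01] by (simp add: n_eq divide_inverse)
  then show ?thesis using D deriv_T_frame[OF t D] by simp
qed

lemma lipschitz_imp_AE_deriv:
  assumes "K-lipschitz_on {0..1} T"
  obtains N where "negligible N" "{0, 1} \<subseteq> N"
    "\<And>t. t \<in> {0..1} - N \<Longrightarrow> (T has_vector_derivative L *\<^sub>R (- \<gamma> t + \<kappa> t *\<^sub>R n t)) (at t)"
proof
  \<comment> \<open>With the endpoints in the null set, only points with a two-sided derivative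
    remain.\<close>
  let ?N = "insert 0 (insert 1 {t \<in> {0<..<1}. \<not> T differentiable at t})"
  show "negligible ?N" using lipschitz_AE_differentiable[OF assms] by (simp add: negligible_insert)
  show "(T has_vector_derivative L *\<^sub>R (- \<gamma> t + \<kappa> t *\<^sub>R n t)) (at t)"
    if "t \<in> {0..1} - ?N" for t
    using that by (intro deriv_unit_tangent) (auto simp: less_le)
qed auto

section \<open>Essential bounds against bounds on upper and lower curvature\<close>

text \<open>\<open>esssup\<close> of a non-measurable function is top by definition, so an upper
  bound for it requires this. Off a null set \<open>\<kappa>\<close> is the pointwise limit of the
  continuous difference quotients \<open>F j\<close>.\<close>

lemma curvature_measurable:
  assumes "K-lipschitz_on {0..1} T"
  shows "\<kappa> \<in> borel_measurable (lebesgue_on {0..1})"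
proof -
  obtain N where N: "negligible N" "{0, 1} \<subseteq> N"
    and D: "\<And>t. t \<in> {0..1} - N \<Longrightarrow> (T has_vector_derivative L *\<^sub>R (- \<gamma> t + \<kappa> t *\<^sub>R n t)) (at t)"
    using lipschitz_imp_AE_deriv[OF assms] by blast
  define h where "h = (\<lambda>j. inverse (real (Suc j)))"
  \<comment> \<open>The \<open>min\<close> keeps the argument in \<open>{0..1}\<close>, where
    \<open>T\<close> is continuous; for fixed \<open>t < 1\<close> it has no effect once
    \<open>h j < 1 - t\<close>.\<close>
  define F where "F = (\<lambda>j t. (T (min 1 (t + h j)) \<bullet> n t - T t \<bullet> n t) / h j / L)"
  have h: "h j > 0" for j by (simp add: h_def)
  have S: "{0..1} - N \<in> sets lebesgue" using negligible_imp_sets[OF N(1)] by (intro sets.Diff) auto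
  have "\<kappa> \<in> borel_measurable (lebesgue_on ({0..1} - N))"
  proof (rule borel_measurable_LIMSEQ_metric)
    fix j
    have cT: "continuous_on {0..1} (\<lambda>t. T (min 1 (t + h j)))"
      by (rule continuous_on_compose2[OF cont_T]) (use h[of j] in \<open>auto intro!: continuous_intros\<close>)
    have "continuous_on {0..1} (F j)"
      unfolding F_def using h[of j] L_pos by (intro continuous_intros cT cont_T cont_n) auto
    then have "continuous_on ({0..1} - N) (F j)" by (rule continuous_on_subset) auto
    then show "F j \<in> borel_measurable (lebesgue_on ({0..1} - N))"
      using S by (rule continuous_imp_measurable_on_sets_lebesgue)
  next
    fix t assume "t \<in> space (lebesgue_on ({0..1} - N))"
    then have tN: "t \<in> {0..1} - N" by simp
    then have t: "0 < t" "t < 1" using N(2) by (auto simp: less_le)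
    have t01: "t \<in> {0..1}" using t by simp
    have h0: "h \<longlonglongrightarrow> 0" unfolding h_def by (rule LIMSEQ_inverse_real_of_nat)
    have "filterlim h (at 0) sequentially"
      using h0 h[THEN less_imp_neq, THEN not_sym] by (simp add: filterlim_at)
    moreover have "((\<lambda>s. T s \<bullet> n t) has_real_derivative (L *\<^sub>R (- \<gamma> t + \<kappa> t *\<^sub>R n t)) \<bullet> n t) (at t)"
      using bounded_linear.has_vector_derivative[OF bounded_linear_inner_left D[OF tN]]
      by (simp add: has_real_derivative_iff_has_vector_derivative)
    then have "((\<lambda>y. (T (t + y) \<bullet> n t - T t \<bullet> n t) / y) \<longlongrightarrow> L * \<kappa> t) (at 0)"
      using frame[OF t01] by (simp add: DERIV_def inner_diff_left)
    ultimately have "(\<lambda>j. (T (t + h j) \<bullet> n t - T t \<bullet> n t) / h j) \<longlonglongrightarrow> L * \<kappa> t"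
      by (rule filterlim_compose[rotated])
    then have "(\<lambda>j. (T (t + h j) \<bullet> n t - T t \<bullet> n t) / h j / L) \<longlonglongrightarrow> L * \<kappa> t / L"
      using L_pos by (intro tendsto_intros) auto
    then have lim: "(\<lambda>j. (T (t + h j) \<bullet> n t - T t \<bullet> n t) / h j / L) \<longlonglongrightarrow> \<kappa> t"
      using L_pos by simp
    have "\<forall>\<^sub>F j in sequentially. h j < 1 - t" using h0 t by (intro order_tendstoD) auto
    then have "\<forall>\<^sub>F j in sequentially. (T (t + h j) \<bullet> n t - T t \<bullet> n t) / h j / L = F j t"
      by eventually_elim (simp add: F_def min_def)
    with lim show "(\<lambda>j. F j t) \<longlonglongrightarrow> \<kappa> t"
      by (rule Lim_transform_eventually)
  qed
  moreover have "{0..1} - N = {0..1} - (N \<inter> {0..1})" by auto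
  moreover have "negligible (N \<inter> {0..1})" by (rule negligible_subset[OF N(1)]) auto
  then have "N \<inter> {0..1} \<in> null_sets (lebesgue_on {0..1})"
    unfolding negligible_iff_null_sets by (subst null_sets_restrict_space) auto
  ultimately show ?thesis using borel_measurable_diff_null[of "N \<inter> {0..1}" "{0..1}" \<kappa>]
    by simp
qed

lemma essential_bounds_imp_tangent_bounds:
  assumes lip: "K-lipschitz_on {0..1} T"
    and lo: "ereal \<kappa>\<^sub>1 < essinf (lebesgue_on {0..1}) (\<lambda>t. ereal (\<kappa> t))"
    and up: "esssup (lebesgue_on {0..1}) (\<lambda>t. ereal (\<kappa> t)) < ereal \<kappa>\<^sub>2"
  shows "ereal \<kappa>\<^sub>1 < (INF t\<in>{0..1}. lower_curvature {0..1} \<gamma> t)"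
    and "(SUP t\<in>{0..1}. upper_curvature {0..1} \<gamma> t) < ereal \<kappa>\<^sub>2"
proof -
  obtain k2 where k2: "esssup (lebesgue_on {0..1}) (\<lambda>t. ereal (\<kappa> t)) < ereal k2"
    "k2 < \<kappa>\<^sub>2"
    using ereal_dense2[OF up] by auto
  obtain k1 where k1: "ereal k1 < essinf (lebesgue_on {0..1}) (\<lambda>t. ereal (\<kappa> t))"
    "\<kappa>\<^sub>1 < k1"
    using ereal_dense2[OF lo] by auto
  have k1': "esssup (lebesgue_on {0..1}) (\<lambda>t. - ereal (\<kappa> t)) < ereal (- k1)"
    using k1(1) unfolding essinf_def by (subst (asm) ereal_less_uminus_reorder) simp
  have "AE t in lebesgue_on {0..1}. ereal (\<kappa> t) \<le> ereal k2"
    using esssup_AE[of "\<lambda>t. ereal (\<kappa> t)" "lebesgue_on {0..1}"]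
      by eventually_elim (erule order_trans[OF _ less_imp_le[OF k2(1)]])
  moreover have "AE t in lebesgue_on {0..1}. - ereal (\<kappa> t) \<le> ereal (- k1)"
    using esssup_AE[of "\<lambda>t. - ereal (\<kappa> t)" "lebesgue_on {0..1}"]
      by eventually_elim (erule order_trans[OF _ less_imp_le[OF k1']])
  ultimately have "AE t in lebesgue_on {0..1}. k1 \<le> \<kappa> t \<and> \<kappa> t \<le> k2"
    by eventually_elim simp
  then obtain N\<^sub>1 where N1: "negligible N\<^sub>1"
    "\<And>t. t \<in> {0..1} - N\<^sub>1 \<Longrightarrow> k1 \<le> \<kappa> t \<and> \<kappa> t \<le> k2"
    by (rule AE_lebesgue_onE) auto
  obtain N\<^sub>2 where N2: "negligible N\<^sub>2" "{0, 1} \<subseteq> N\<^sub>2"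
    "\<And>t. t \<in> {0..1} - N\<^sub>2 \<Longrightarrow> (T has_vector_derivative L *\<^sub>R (- \<gamma> t + \<kappa> t *\<^sub>R n t)) (at t)"
    using lipschitz_imp_AE_deriv[OF lip] by blast
  have N: "negligible (N\<^sub>1 \<union> N\<^sub>2)" using N1(1) N2(1) by (rule negligible_Un)
  \<comment> \<open>A second intermediate constant on each side:
    \<open>curvature_le_imp_contact\<close> uses up one strict gap, and the bounds over all
    \<open>t\<close> must still be strict.\<close>
  obtain k2' where k2': "k2 < k2'" "k2' < \<kappa>\<^sub>2" using dense[OF k2(2)] by blast
  obtain k1' where k1': "\<kappa>\<^sub>1 < k1'" "k1' < k1" using dense[OF k1(2)] by blast
  have "contact 1 k2' t" if "t \<in> {0..1}" for t
  proof (rule curvature_le_imp_contact[OF lip N _ k2'(1) that, where B = "\<bar>k1\<bar> + \<bar>k2\<bar>"])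
    fix s assume "s \<in> {0<..<1} - (N\<^sub>1 \<union> N\<^sub>2)"
    then show "\<exists>\<kappa>. (T has_vector_derivative L *\<^sub>R (- \<gamma> s + \<kappa> *\<^sub>R n s)) (at s) \<and> 1 * \<kappa> \<le> k2 \<and> \<bar>\<kappa>\<bar> \<le> \<bar>k1\<bar> + \<bar>k2\<bar>"
      using N1(2)[of s] N2(3)[of s] by (intro exI[of _ "\<kappa> s"]) auto
  qed
  then have "(SUP t\<in>{0..1}. upper_curvature {0..1} \<gamma> t) \<le> ereal k2'"
    by (intro SUP_least) (auto simp: upper_curvature_eq intro!: Inf_lower)
  then show "(SUP t\<in>{0..1}. upper_curvature {0..1} \<gamma> t) < ereal \<kappa>\<^sub>2"
    using k2'(2) by (simp add: le_less_trans)
  have "contact (-1) (- k1') t" if "t \<in> {0..1}" for t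
  proof (rule curvature_le_imp_contact[OF lip N _ _ that, where k = "- k1" and B = "\<bar>k1\<bar> + \<bar>k2\<bar>"])
    show "- k1 < - k1'" using k1'(2) by simp
    fix s assume "s \<in> {0<..<1} - (N\<^sub>1 \<union> N\<^sub>2)"
    then show "\<exists>\<kappa>. (T has_vector_derivative L *\<^sub>R (- \<gamma> s + \<kappa> *\<^sub>R n s)) (at s) \<and> -1 * \<kappa> \<le> - k1 \<and> \<bar>\<kappa>\<bar> \<le> \<bar>k1\<bar> + \<bar>k2\<bar>"
      using N1(2)[of s] N2(3)[of s] by (intro exI[of _ "\<kappa> s"]) auto
  qed
  then have "ereal k1' \<le> (INF t\<in>{0..1}. lower_curvature {0..1} \<gamma> t)"
    by (intro INF_greatest) (auto simp: lower_curvature_eq intro!: Sup_upper)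
  then show "ereal \<kappa>\<^sub>1 < (INF t\<in>{0..1}. lower_curvature {0..1} \<gamma> t)"
    by (rule less_le_trans[rotated]) (use k1'(1) in simp)
qed

text \<open>The strict bounds leave room for constants \<open>k1\<close> and \<open>k2\<close> in
  contact at every \<open>t\<close>. Contact from both sides makes \<open>T\<close> Lipschitz, hence
  differentiable almost everywhere, and at each such point \<open>contact_imp_curvature_le\<close>
  puts the curvature between \<open>k1\<close> and \<open>k2\<close>.\<close>

lemma tangent_bounds_imp_essential_bounds:
  assumes lo: "ereal \<kappa>\<^sub>1 < (INF t\<in>{0..1}. lower_curvature {0..1} \<gamma> t)"
    and up: "(SUP t\<in>{0..1}. upper_curvature {0..1} \<gamma> t) < ereal \<kappa>\<^sub>2"
  shows "\<exists>K. K-lipschitz_on {0..1} T"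
    and "ereal \<kappa>\<^sub>1 < essinf (lebesgue_on {0..1}) (\<lambda>t. ereal (\<kappa> t))"
    and "esssup (lebesgue_on {0..1}) (\<lambda>t. ereal (\<kappa> t)) < ereal \<kappa>\<^sub>2"
proof -
  obtain k2 where k2: "(SUP t\<in>{0..1}. upper_curvature {0..1} \<gamma> t) < ereal k2"
    "k2 < \<kappa>\<^sub>2"
    using ereal_dense2[OF up] by auto
  obtain k1 where k1: "ereal k1 < (INF t\<in>{0..1}. lower_curvature {0..1} \<gamma> t)"
    "\<kappa>\<^sub>1 < k1"
    using ereal_dense2[OF lo] by auto
  have c2: "contact 1 k2 t" if "t \<in> {0..1}" for t
    using that by (intro upper_curvature_less_imp_contact le_less_trans[OF SUP_upper k2(1)])
  have c1: "contact (-1) (- k1) t" if "t \<in> {0..1}" for t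
    using that by (intro less_lower_curvature_imp_contact less_le_trans[OF k1(1) INF_lower])
  show "\<exists>K. K-lipschitz_on {0..1} T"
    by (rule contact_imp_lipschitz[of k2 "- k1"]) (auto intro!: c1 c2)
  then obtain K where K: "K-lipschitz_on {0..1} T" ..
  obtain N where N: "negligible N" "{0, 1} \<subseteq> N"
    "\<And>t. t \<in> {0..1} - N \<Longrightarrow> (T has_vector_derivative L *\<^sub>R (- \<gamma> t + \<kappa> t *\<^sub>R n t)) (at t)"
    using lipschitz_imp_AE_deriv[OF K] by blast
  have b: "k1 \<le> \<kappa> t \<and> \<kappa> t \<le> k2" if tN: "t \<in> {0..1} - N" for t
  proof -
    have t: "0 < t" "t < 1" "t \<in> {0..1}" using tN N(2) by (auto simp: less_le)
    show ?thesis
      using contact_imp_curvature_le[OF t(1,2) N(3)[OF tN] c2[OF t(3)]]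
        contact_imp_curvature_le[OF t(1,2) N(3)[OF tN] c1[OF t(3)]] by simp
  qed
  have [measurable]: "\<kappa> \<in> borel_measurable (lebesgue_on {0..1})"
    by (rule curvature_measurable[OF K])
  have "esssup (lebesgue_on {0..1}) (\<lambda>t. ereal (\<kappa> t)) \<le> ereal k2"
    using b by (intro esssup_I AE_lebesgue_onI[OF N(1)]) auto
  then show "esssup (lebesgue_on {0..1}) (\<lambda>t. ereal (\<kappa> t)) < ereal \<kappa>\<^sub>2"
    using k2(2) by (simp add: le_less_trans)
  have "esssup (lebesgue_on {0..1}) (\<lambda>t. - ereal (\<kappa> t)) \<le> ereal (- k1)"
    using b by (intro esssup_I AE_lebesgue_onI[OF N(1)]) auto
  then have "ereal k1 \<le> essinf (lebesgue_on {0..1}) (\<lambda>t. ereal (\<kappa> t))"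
    unfolding essinf_def by (subst ereal_minus_le_minus[symmetric]) simp
  then show "ereal \<kappa>\<^sub>1 < essinf (lebesgue_on {0..1}) (\<lambda>t. ereal (\<kappa> t))"
    by (rule less_le_trans[rotated]) (use k1(2) in simp)
qed

end

section \<open>Equality of the two spaces\<close>

lemma const_speed_rep_regular:
  assumes "C \<in> regular_curves" "const_speed_rep C \<gamma>"
  obtains L where "const_speed_regular_curve \<gamma> L"
proof -
  obtain p where "C = reparam `` {p}"
    using assms(1) unfolding regular_curves_def by (rule quotientE)
  then have "(p, (0, 1, \<gamma>)) \<in> reparam" using assms(2) by (simp add: const_speed_rep_def)
  then have "(0, 1, \<gamma>) \<in> regular_pcurves" by (auto simp: reparam_def)
  moreover obtain L
    where "\<And>t. t \<in> {0..1} \<Longrightarrow> norm (velocity {0..1} \<gamma> t) = L"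
    using assms(2) by (auto simp: const_speed_rep_def)
  ultimately have "const_speed_regular_curve \<gamma> L" unfolding const_speed_regular_curve_def by blast
  then show thesis by (rule that)
qed

text \<open>The middle inequalities hold for every such curve: lower and upper curvature are ordered
  already at \<open>0\<close>, and \<open>{0..1}\<close> has positive measure. The outer
  inequalities and the Lipschitz condition come from the two preceding implications.\<close>

lemma (in const_speed_regular_curve) essential_bounds_iff_tangent_bounds:
  "(\<exists>K. K-lipschitz_on {0..1} (velocity {0..1} \<gamma>))
     \<and> (let \<kappa> = (\<lambda>t. ereal (geodesic_curvature {0..1} \<gamma> t)); \<mu> = lebesgue_on {0..1} in
          ereal \<kappa>\<^sub>1 < essinf \<mu> \<kappa> \<and> essinf \<mu> \<kappa> \<le> esssup \<mu> \<kappa> \<and> esssup \<mu> \<kappa> < ereal \<kappa>\<^sub>2)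
   \<longleftrightarrow> (let m = (INF t\<in>{0..1}. lower_curvature {0..1} \<gamma> t);
            M = (SUP t\<in>{0..1}. upper_curvature {0..1} \<gamma> t) in
          ereal \<kappa>\<^sub>1 < m \<and> m \<le> M \<and> M < ereal \<kappa>\<^sub>2)"
proof -
  have "(INF t\<in>{0..1}. lower_curvature {0..1} \<gamma> t) \<le> lower_curvature {0..1} \<gamma> 0"
    by (rule INF_lower) simp
  also have "\<dots> \<le> upper_curvature {0..1} \<gamma> 0" by (rule lower_le_upper_curvature) simp
  also have "\<dots> \<le> (SUP t\<in>{0..1}. upper_curvature {0..1} \<gamma> t)"
    by (rule SUP_upper) simp
  finally have 1: "(INF t\<in>{0..1}. lower_curvature {0..1} \<gamma> t) \<le> (SUP t\<in>{0..1}. upper_curvature {0..1} \<gamma> t)" .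
  have "essinf (lebesgue_on {0..1}) (\<lambda>t. ereal (\<kappa> t)) \<le> esssup (lebesgue_on {0..1}) (\<lambda>t. ereal (\<kappa> t))"
    by (rule essinf_le_esssup) (simp add: emeasure_restrict_space)
  with 1 show ?thesis
    unfolding lipschitz_velocity_iff Let_def
    using essential_bounds_imp_tangent_bounds tangent_bounds_imp_essential_bounds by metis
qed

theorem theorem1:
  fixes \<kappa>\<^sub>1 \<kappa>\<^sub>2 :: real and P Q :: "real^3^3"
  assumes "\<kappa>\<^sub>1 < \<kappa>\<^sub>2" and "rotation_matrix P" and "rotation_matrix Q"
  shows "P_space \<kappa>\<^sub>1 \<kappa>\<^sub>2 P Q = S_space \<kappa>\<^sub>1 \<kappa>\<^sub>2 P Q"
  unfolding P_space_def S_space_def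
\<comment> \<open>Both spaces quantify over the same constant-speed representatives, so the two
  conditions are compared for each \<open>\<gamma>\<close> separately.\<close>
proof (intro Collect_cong conj_cong refl ex_cong1)
  fix C \<gamma> assume "C \<in> curves_between P Q" "const_speed_rep C \<gamma>"
  then obtain L where "const_speed_regular_curve \<gamma> L"
    using const_speed_rep_regular unfolding curves_between_def by blast
  then show "(\<exists>K. K-lipschitz_on {0..1} (velocity {0..1} \<gamma>))
     \<and> (let \<kappa> = (\<lambda>t. ereal (geodesic_curvature {0..1} \<gamma> t)); \<mu> = lebesgue_on {0..1} in
          ereal \<kappa>\<^sub>1 < essinf \<mu> \<kappa> \<and> essinf \<mu> \<kappa> \<le> esssup \<mu> \<kappa> \<and> esssup \<mu> \<kappa> < ereal \<kappa>\<^sub>2)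
    \<longleftrightarrow> (let m = (INF t\<in>{0..1}. lower_curvature {0..1} \<gamma> t);
            M = (SUP t\<in>{0..1}. upper_curvature {0..1} \<gamma> t) in
          ereal \<kappa>\<^sub>1 < m \<and> m \<le> M \<and> M < ereal \<kappa>\<^sub>2)"
    by (rule const_speed_regular_curve.essential_bounds_iff_tangent_bounds)
qed

end
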